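(* Consider the problem, the i.i.d. sampling and multiplicative noise assumptions, and Algorithm 2 described in the context. Let $\mu\in(0,1)$ and $\phi\in(0,1)$ such that $\phi\in(0,1-\mu c/L)$. Choose $\zeta\in(0,1)$ and $N_0\in\mathbb{N}$ and set the stepsize and sampling rate sequences as $$\alpha_t\equiv\alpha:=\frac{\mu}{L},\qquad N_t:=N_0\lceil\zeta^{-t}\rceil\qquad(t\in\mathbb{N}).$$ Define $$\rho:=\max\left\{1-\mu\frac{c}{2L}+\phi,\ \zeta\right\}<1 .$$ Let $$t_0:=\max\left\{\left\lceil\log_{\frac1\zeta}\left(\frac{2\mu^2}{(1-\mu)\phi N_0}\cdot\frac{\sigma_L^2}{L^2}\right)\right\rceil,\ 1\right\}.$$ Let $\{x^t\}$ be generated by Algorithm 2 with these parameters and let $x^*$ be the unique solution of $\min_{x\in X}g(x)$. Then there exists a constant $\mathsf{C}>0$ such that $$\mathbb{E}[\|x^{t+1}-x^*\|^2]\le\mathsf{C}\rho^{t+1},\qquad\forall t\ge1,$$ $$\mathbb{E}\left[g(x^{t+1})-g^*\right]\le\left[\frac{L\mu^{-1}-c}{2}+\frac{2\mu}{(1-\mu)N_0}\cdot\frac{\sigma_L^2}{L}\zeta^t\right]\mathsf{C}\rho^t+\frac{2\mu}{(1-\mu)N_0}\cdot\frac{\sigma(x^* )^2}{L}\zeta^t,\qquad\forall t\ge2.$$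
   Context: Setting. $\mathbb{N}=\{1,2,\dots\}$; $\lceil x\rceil$ is the smallest integer $\ge x$; $\|\cdot\|$ is the Euclidean norm. $X\subset\mathbb{R}^d$ is closed and convex, $\mathbf{P}$ is a probability distribution on $\Xi$, and $F:X\times\Xi\to\mathbb{R}$ is measurable, such that for a.e. $\xi$ the function $F(\cdot,\xi)$ is convex and continuously differentiable, and $F(x,\cdot)$, $\nabla F(x,\cdot)$ are integrable for every $x\in X$. Here $\nabla F$ is the gradient in $x$. Set $f(x):=\mathbb{E}[F(x,\xi)]$ with $\xi\sim\mathbf{P}$; $f$ is differentiable on $X$ with $\nabla f(x)=\mathbb{E}[\nabla F(x,\xi)]$, and for some $L>0$ and $c>0$, $\|\nabla f(x)-\nabla f(y)\|\le L\|x-y\|$ and $f(x)+\langle\nabla f(x),y-x\rangle+\frac c2\|y-x\|^2\le f(y)$ for all $x,y\in X$. $\varphi:X\to\mathbb{R}$ is a (possibly nonsmooth) convex function whose proximal minimizations (as in the algorithm below) are well defined. The problem is $g^*:=\min_{x\in X}\{g(x):=f(x)+\varphi(x)\}$, which has a unique solution $x^*$. Multiplicative noise assumption. Let $\sigma(x):=\sqrt{\mathbb{E}[\|\nabla F(x,\xi)-\nabla f(x)\|^2]}$. There is $x^0\in X$ with $\sigma(x^0)<\infty$, and there is $\sigma_L>0$ such that $\sigma(x)\le\sigma(y)+\sigma_L\|x-y\|$ for all $x,y\in X$. Algorithm 2. Inputs: initial point $x^1\in X$, stepsizes $\alpha_t>0$, batch sizes $N_t\in\mathbb{N}$. At iteration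 $t\ge1$, given $x^t$, draw an i.i.d. sample $\xi^t=\{\xi^t_j\}_{j=1}^{N_t}$ from $\mathbf{P}$, independent of all previous samples, put $F'_t(x^t,\xi^t):=\frac1{N_t}\sum_{j=1}^{N_t}\nabla F(x^t,\xi^t_j)$ and $$x^{t+1}:=\operatorname*{argmin}_{x\in X}\left\{f(x^t)+\langle F'_t(x^t,\xi^t),x-x^t\rangle+\frac1{2\alpha_t}\|x-x^t\|^2+\varphi(x)\right\}.$$
   Formalization: The displayed claim ρ<1 fails for some allowed φ (c=L, μ=1/2, φ=0.4 gives ρ≥1.15); it is replaced by the criterion ρ<1 if and only if φ<μc/(2L), and both bounds are proved for the whole stated range of φ, whether or not ρ<1. *)

theory Defs
  imports "HOL-Probability.Probability"
begin

text \<open>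
  Used both for the objective (\<open>mean P F\<close>) and for its gradient (\<open>mean P gradF\<close>).
\<close>

definition mean :: "'b measure \<Rightarrow> ('a \<Rightarrow> 'b \<Rightarrow> 'c :: {banach, second_countable_topology}) \<Rightarrow> 'a \<Rightarrow> 'c"
  where "mean P H x = (\<integral>\<xi>. H x \<xi> \<partial>P)"

text \<open>
  The standard deviation of the random vector \<open>G x \<xi>\<close> is an extended nonnegative real, so that
  it is infinite, rather than a default value, when the second moment is infinite.
\<close>

definition noise_sd :: "'b measure \<Rightarrow> ('a \<Rightarrow> 'b \<Rightarrow> 'c :: euclidean_space) \<Rightarrow> 'a \<Rightarrow> ennreal"
  where "noise_sd P G x =
    (let v = \<integral>\<^sup>+\<xi>. ennreal ((norm (G x \<xi> - mean P G x))\<^sup>2) \<partial>P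
     in if v = \<infinity> then \<infinity> else ennreal (sqrt (enn2real v)))"

definition objective :: "'b measure \<Rightarrow> ('a \<Rightarrow> 'b \<Rightarrow> real) \<Rightarrow> ('a \<Rightarrow> real) \<Rightarrow> 'a \<Rightarrow> real"
  where "objective P F \<psi> x = mean P F x + \<psi> x"

text \<open>
  The domain \<open>X\<close> may have empty interior and \<open>F\<close> only matters on \<open>X\<close>, so gradients are taken
  within \<open>X\<close>. As they need not be unique then, the gradient field \<open>gradF\<close> is part of the data.
  For \<open>\<xi>\<close> in the exceptional null set the value of \<open>gradF\<close> is a convention; it is only required
  to be such that \<open>gradF\<close> is measurable.
\<close>

locale composite_problem =
  fixes P :: "'b measure"
    and X :: "'a :: euclidean_space set"
    and F :: "'a \<Rightarrow> 'b \<Rightarrow> real"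
    and gradF :: "'a \<Rightarrow> 'b \<Rightarrow> 'a"
    and \<psi> :: "'a \<Rightarrow> real"
    and L c :: real
  assumes prob_P: "prob_space P"
    and closed_X: "closed X"
    and convex_X: "convex X"
    and F_measurable:
      "(\<lambda>(x, \<xi>). F x \<xi>) \<in> borel_measurable (restrict_space borel X \<Otimes>\<^sub>M P)"
    and gradF_measurable:
      "(\<lambda>(x, \<xi>). gradF x \<xi>) \<in> borel_measurable (restrict_space borel X \<Otimes>\<^sub>M P)"
    and F_convex: "AE \<xi> in P. convex_on X (\<lambda>x. F x \<xi>)"
    and F_gradient: "AE \<xi> in P. \<forall>x\<in>X.
      ((\<lambda>y. F y \<xi>) has_derivative (\<lambda>h. gradF x \<xi> \<bullet> h)) (at x within X)"
    and F_gradient_continuous: "AE \<xi> in P. continuous_on X (\<lambda>x. gradF x \<xi>)"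
    and F_integrable: "\<And>x. x \<in> X \<Longrightarrow> integrable P (F x)"
    and gradF_integrable: "\<And>x. x \<in> X \<Longrightarrow> integrable P (gradF x)"
    and f_gradient: "\<And>x. x \<in> X \<Longrightarrow>
      (mean P F has_derivative (\<lambda>h. mean P gradF x \<bullet> h)) (at x within X)"
    and L_pos: "L > 0"
    and c_pos: "c > 0"
    and f_smooth: "\<And>x y. x \<in> X \<Longrightarrow> y \<in> X \<Longrightarrow>
      norm (mean P gradF x - mean P gradF y) \<le> L * norm (x - y)"
    and f_strongly_convex: "\<And>x y. x \<in> X \<Longrightarrow> y \<in> X \<Longrightarrow>
      mean P F x + mean P gradF x \<bullet> (y - x) + c / 2 * (norm (y - x))\<^sup>2 \<le> mean P F y"
    and \<psi>_convex: "convex_on X \<psi>"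

definition unique_minimizer :: "'a set \<Rightarrow> ('a \<Rightarrow> real) \<Rightarrow> 'a \<Rightarrow> bool"
  where "unique_minimizer X g x \<longleftrightarrow>
    is_arg_min g (\<lambda>y. y \<in> X) x \<and> (\<forall>y. is_arg_min g (\<lambda>y. y \<in> X) y \<longrightarrow> y = x)"

definition multiplicative_noise ::
    "'b measure \<Rightarrow> 'a set \<Rightarrow> ('a \<Rightarrow> 'b \<Rightarrow> 'a :: euclidean_space) \<Rightarrow> real \<Rightarrow> bool"
  where "multiplicative_noise P X G \<sigma>\<^sub>L \<longleftrightarrow>
    \<sigma>\<^sub>L > 0 \<and> (\<exists>x\<in>X. noise_sd P G x < \<infinity>) \<and>
    (\<forall>x\<in>X. \<forall>y\<in>X. noise_sd P G x \<le> noise_sd P G y + ennreal (\<sigma>\<^sub>L * norm (x - y)))"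

definition iid_samples ::
    "'w measure \<Rightarrow> 'b measure \<Rightarrow> (nat \<Rightarrow> nat) \<Rightarrow> (nat \<Rightarrow> nat \<Rightarrow> 'w \<Rightarrow> 'b) \<Rightarrow> bool"
  where "iid_samples M P N \<xi> \<longleftrightarrow>
    prob_space.indep_vars M (\<lambda>_. P) (\<lambda>(t, j). \<xi> t j) {(t, j). 1 \<le> t \<and> 1 \<le> j \<and> j \<le> N t} \<and>
    (\<forall>t j. 1 \<le> t \<and> 1 \<le> j \<and> j \<le> N t \<longrightarrow> distr M P (\<xi> t j) = P)"

definition batch_gradient ::
    "('a \<Rightarrow> 'b \<Rightarrow> 'a :: euclidean_space) \<Rightarrow> (nat \<Rightarrow> nat) \<Rightarrow> (nat \<Rightarrow> nat \<Rightarrow> 'w \<Rightarrow> 'b) \<Rightarrow>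
      nat \<Rightarrow> 'w \<Rightarrow> 'a \<Rightarrow> 'a"
  where "batch_gradient G N \<xi> t \<omega> u = (1 / real (N t)) *\<^sub>R (\<Sum>j = 1..N t. G u (\<xi> t j \<omega>))"

text \<open>
  A run of the stochastic proximal gradient method on the sample space \<open>M\<close>; the iterates are
  \<open>x 1, x 2, \<dots>\<close>, and \<open>x 0\<close> is irrelevant. The objective of the proximal minimization is strongly
  convex, so it has at most one minimizer; that it has one at every visited point is part of
  \<open>x_step\<close>.
\<close>

locale stochastic_prox_gradient = composite_problem P X F gradF \<psi> L c
  for P :: "'b measure" and X :: "'a :: euclidean_space set" and F gradF \<psi> L c +
  fixes M :: "'w measure"
    and \<xi> :: "nat \<Rightarrow> nat \<Rightarrow> 'w \<Rightarrow> 'b"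
    and \<alpha> :: "nat \<Rightarrow> real"
    and N :: "nat \<Rightarrow> nat"
    and x\<^sub>1 :: 'a
    and x :: "nat \<Rightarrow> 'w \<Rightarrow> 'a"
  assumes prob_M: "prob_space M"
    and samples: "iid_samples M P N \<xi>"
    and \<alpha>_pos: "\<And>t. 1 \<le> t \<Longrightarrow> \<alpha> t > 0"
    and N_pos: "\<And>t. 1 \<le> t \<Longrightarrow> N t \<ge> 1"
    and x\<^sub>1_in: "x\<^sub>1 \<in> X"
    and x_init: "\<And>\<omega>. \<omega> \<in> space M \<Longrightarrow> x 1 \<omega> = x\<^sub>1"
    and x_step: "\<And>t \<omega>. 1 \<le> t \<Longrightarrow> \<omega> \<in> space M \<Longrightarrow>
      is_arg_min
        (\<lambda>y. mean P F (x t \<omega>) + batch_gradient gradF N \<xi> t \<omega> (x t \<omega>) \<bullet> (y - x t \<omega>)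
             + 1 / (2 * \<alpha> t) * (norm (y - x t \<omega>))\<^sup>2 + \<psi> y)
        (\<lambda>y. y \<in> X) (x (t + 1) \<omega>)"

end

theory Submission
  imports Defs
begin

text \<open>
  Write \<open>f\<close> for the mean of \<open>F\<close>, \<open>e\<close> for the error of the batch gradient at \<open>x t\<close> and \<open>D t\<close> for
  the mean squared distance of \<open>x t\<close> from the minimizer \<open>x\<^sub>s\<close>. Three facts about a single step are
  added up: the proximal objective grows quadratically away from its minimizer
  (\<open>prox_point_three_point\<close>), \<open>f\<close> lies below its quadratic model with curvature \<open>L\<close>
  (\<open>lipschitz_gradient_upper_bound\<close>), and above the one with curvature \<open>c\<close>. The mean gradients
  cancel, and what remains (\<open>one_step\<close>) bounds the optimality gap plus \<open>1 / (2 \<alpha>)\<close> times the new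
  squared distance by \<open>(1 / \<alpha> - c) / 2\<close> times the old squared distance, a multiple of \<open>\<parallel>e\<parallel>\<^sup>2\<close>, and
  the term \<open>- e \<bullet> (x t - x\<^sub>s)\<close>.

  In expectation the last term vanishes, because the batch is independent of \<open>x t\<close>. For the same
  reason the errors of the members of a batch are uncorrelated, so \<open>E \<parallel>e\<parallel>\<^sup>2\<close> is at most of order
  \<open>(\<sigma>\<^sup>2 + \<sigma>\<^sub>L\<^sup>2 D t) / N t\<close>, where \<open>\<sigma>\<close> is the standard deviation of the gradient at \<open>x\<^sub>s\<close>. As
  \<open>1 / N t\<close> decays like \<open>\<zeta>\<^sup>t\<close>, the distances obey a contraction with a vanishing perturbation of
  the factor and a geometrically decaying additive term
  (\<open>expected_step\<close>, \<open>geometric_bound_of_recursion\<close>).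

  The independence argument needs \<open>x t\<close> to be measurable with respect to the other samples, although
  the iterates are only characterized as minimizers. Two facts supply this: a proximal point is
  a nonexpansive function of its centre, and a function that is continuous on a set, Borel or not,
  preserves the measurability of maps into that set (\<open>measurable_prox_point\<close>,
  \<open>iterate_measurable\<close>). The same device makes the values of \<open>\<psi>\<close> along the iterates measurable.
\<close>


section \<open>Proximal points of a convex function\<close>

definition prox_point :: "real \<Rightarrow> 'a :: euclidean_space set \<Rightarrow> ('a \<Rightarrow> real) \<Rightarrow> 'a \<Rightarrow> 'a \<Rightarrow> bool"
  where "prox_point \<alpha> X \<psi> v p \<longleftrightarrow>
    is_arg_min (\<lambda>y. 1 / (2 * \<alpha>) * (norm (y - v))\<^sup>2 + \<psi> y) (\<lambda>y. y \<in> X) p"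

lemma norm_convex_combination_squared:
  fixes u w :: "'a :: real_inner"
  shows "(norm ((1 - l) *\<^sub>R u + l *\<^sub>R w))\<^sup>2
    = (1 - l) * (norm u)\<^sup>2 + l * (norm w)\<^sup>2 - l * (1 - l) * (norm (w - u))\<^sup>2"
  unfolding power2_norm_eq_inner
  by (simp add: inner_simps inner_commute algebra_simps power2_eq_square)

text \<open>
  The proximal objective has strong convexity modulus \<open>1 / \<alpha>\<close>, inherited from the square, so it
  grows quadratically away from its minimizer. Minimality is compared with the points of the
  segment from \<open>p\<close> to \<open>y\<close>, which then approach \<open>p\<close>.
\<close>

lemma prox_point_three_point:
  assumes "0 < \<alpha>" and X: "convex X" and \<psi>: "convex_on X \<psi>"
    and p: "prox_point \<alpha> X \<psi> v p" and y: "y \<in> X"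
  shows "1 / (2 * \<alpha>) * (norm (p - v))\<^sup>2 + \<psi> p + 1 / (2 * \<alpha>) * (norm (y - p))\<^sup>2
    \<le> 1 / (2 * \<alpha>) * (norm (y - v))\<^sup>2 + \<psi> y"
proof -
  define a where "a = 1 / (2 * \<alpha>)"
  have "p \<in> X" using p by (simp add: prox_point_def is_arg_min_def)
  have step: "(1 - l) * (a * (norm (y - p))\<^sup>2)
      \<le> a * (norm (y - v))\<^sup>2 + \<psi> y - a * (norm (p - v))\<^sup>2 - \<psi> p"
    if l: "0 < l" "l < 1" for l
  proof -
    define z where "z = (1 - l) *\<^sub>R p + l *\<^sub>R y"
    have "z \<in> X"
      using X \<open>p \<in> X\<close> y l unfolding z_def by (simp add: convexD)
    then have "a * (norm (p - v))\<^sup>2 + \<psi> p \<le> a * (norm (z - v))\<^sup>2 + \<psi> z"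
      using p unfolding prox_point_def is_arg_min_def a_def by force
    moreover have "\<psi> z \<le> (1 - l) * \<psi> p + l * \<psi> y"
      using \<psi> l \<open>p \<in> X\<close> y unfolding z_def by (intro convex_onD) auto
    moreover have "z - v = (1 - l) *\<^sub>R (p - v) + l *\<^sub>R (y - v)"
      by (simp add: z_def algebra_simps)
    then have "(norm (z - v))\<^sup>2 = (1 - l) * (norm (p - v))\<^sup>2 + l * (norm (y - v))\<^sup>2
        - l * (1 - l) * (norm (y - p))\<^sup>2"
      using norm_convex_combination_squared[of l "p - v" "y - v"] by simp
    ultimately have "a * (norm (p - v))\<^sup>2 + \<psi> p
        \<le> a * ((1 - l) * (norm (p - v))\<^sup>2 + l * (norm (y - v))\<^sup>2 - l * (1 - l) * (norm (y - p))\<^sup>2)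
          + ((1 - l) * \<psi> p + l * \<psi> y)"
      by simp
    then have "l * ((1 - l) * (a * (norm (y - p))\<^sup>2))
        \<le> l * (a * (norm (y - v))\<^sup>2 + \<psi> y - a * (norm (p - v))\<^sup>2 - \<psi> p)"
      by (simp add: algebra_simps)
    then show ?thesis using l by simp
  qed
  have "a * (norm (y - p))\<^sup>2 \<le> a * (norm (y - v))\<^sup>2 + \<psi> y - a * (norm (p - v))\<^sup>2 - \<psi> p"
  proof (rule field_le_mult_one_interval)
    fix l :: real assume "0 < l" "l < 1"
    then show "l * (a * (norm (y - p))\<^sup>2)
        \<le> a * (norm (y - v))\<^sup>2 + \<psi> y - a * (norm (p - v))\<^sup>2 - \<psi> p"
      using step[of "1 - l"] by simp
  qed
  then show ?thesis by (simp add: a_def)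
qed

text \<open>
  Completing the square: a linear term in a proximal objective amounts to a shift of the centre
  and a constant, so each step of the method is a proximal point.
\<close>

lemma prox_centre_shift:
  fixes G u y :: "'a :: real_inner"
  assumes "0 < \<alpha>"
  shows "1 / (2 * \<alpha>) * (norm (y - (u - \<alpha> *\<^sub>R G)))\<^sup>2
    = G \<bullet> (y - u) + 1 / (2 * \<alpha>) * (norm (y - u))\<^sup>2 + \<alpha> / 2 * (norm G)\<^sup>2"
proof -
  have "(norm (y - (u - \<alpha> *\<^sub>R G)))\<^sup>2
      = (norm (y - u))\<^sup>2 + 2 * \<alpha> * (G \<bullet> (y - u)) + \<alpha>\<^sup>2 * (norm G)\<^sup>2"
    unfolding power2_norm_eq_inner
    by (simp add: inner_simps inner_commute algebra_simps power2_eq_square)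
  then show ?thesis
    using assms by (simp add: field_simps power2_eq_square)
qed

lemma prox_point_nonexpansive:
  assumes \<alpha>: "0 < \<alpha>" and X: "convex X" and \<psi>: "convex_on X \<psi>"
    and p: "prox_point \<alpha> X \<psi> v p" and p': "prox_point \<alpha> X \<psi> v' p'"
  shows "norm (p - p') \<le> norm (v - v')"
proof -
  define a where "a = 1 / (2 * \<alpha>)"
  have "a > 0" using \<alpha> by (simp add: a_def)
  have "p \<in> X" "p' \<in> X" using p p' by (auto simp: prox_point_def is_arg_min_def)
  then have "a * (norm (p - v))\<^sup>2 + \<psi> p + a * (norm (p' - p))\<^sup>2 \<le> a * (norm (p' - v))\<^sup>2 + \<psi> p'"
    and "a * (norm (p' - v'))\<^sup>2 + \<psi> p' + a * (norm (p - p'))\<^sup>2 \<le> a * (norm (p - v'))\<^sup>2 + \<psi> p"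
    using prox_point_three_point[OF \<alpha> X \<psi> p] prox_point_three_point[OF \<alpha> X \<psi> p']
    by (simp_all add: a_def)
  then have "a * ((norm (p - v))\<^sup>2 + (norm (p' - p))\<^sup>2 + (norm (p' - v'))\<^sup>2 + (norm (p - p'))\<^sup>2)
      \<le> a * ((norm (p' - v))\<^sup>2 + (norm (p - v'))\<^sup>2)"
    by (simp add: algebra_simps)
  then have "(norm (p - v))\<^sup>2 + (norm (p' - p))\<^sup>2 + (norm (p' - v'))\<^sup>2 + (norm (p - p'))\<^sup>2
      \<le> (norm (p' - v))\<^sup>2 + (norm (p - v'))\<^sup>2"
    using \<open>a > 0\<close> by simp
  then have "(norm (p - p'))\<^sup>2 \<le> (p - p') \<bullet> (v - v')"
    unfolding power2_norm_eq_inner by (simp add: inner_simps inner_commute)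
  also have "\<dots> \<le> norm (p - p') * norm (v - v')"
    by (rule norm_cauchy_schwarz)
  finally have "norm (p - p') * norm (p - p') \<le> norm (p - p') * norm (v - v')"
    by (simp add: power2_eq_square)
  then show ?thesis
    by (cases "p = p'") simp_all
qed

text \<open>
  A convex \<open>\<psi>\<close> can be irregular on the relative boundary of \<open>X\<close>, and the points at
  which a proximal point exists need not form a Borel set. Along proximal points \<open>\<psi>\<close> is
  nevertheless tame: the two values at \<open>p\<close> and \<open>p'\<close> bound each other through minimality, so both
  the proximal map and \<open>\<psi>\<close> composed with it are continuous where they are defined, which is
  enough for measurability.
\<close>

lemma measurable_prox_point:
  fixes v p :: "'w \<Rightarrow> 'a :: euclidean_space"
  assumes \<alpha>: "0 < \<alpha>" and X: "convex X" and \<psi>: "convex_on X \<psi>"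
    and v: "v \<in> borel_measurable S"
    and p: "\<And>\<omega>. \<omega> \<in> space S \<Longrightarrow> prox_point \<alpha> X \<psi> (v \<omega>) (p \<omega>)"
  shows "p \<in> borel_measurable S" and "(\<lambda>\<omega>. \<psi> (p \<omega>)) \<in> borel_measurable S"
proof -
  define V where "V = {z. \<exists>q. prox_point \<alpha> X \<psi> z q}"
  define q where "q z = (SOME q. prox_point \<alpha> X \<psi> z q)" for z
  have q: "prox_point \<alpha> X \<psi> z (q z)" if "z \<in> V" for z
    using that unfolding V_def q_def by (auto intro: someI)
  have q_in: "q z \<in> X" if "z \<in> V" for z
    using q[OF that] by (simp add: prox_point_def is_arg_min_def)
  have qv: "q (v \<omega>) = p \<omega>" if "\<omega> \<in> space S" for \<omega>
  proof -
    have "v \<omega> \<in> V" using p[OF that] unfolding V_def by auto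
    then show ?thesis using prox_point_nonexpansive[OF \<alpha> X \<psi> q p[OF that], of "v \<omega>"] by simp
  qed
  have cont_q: "continuous_on V q"
    unfolding continuous_on_iff
  proof (intro ballI allI impI)
    fix z e :: _ assume "z \<in> V" "(0::real) < e"
    then show "\<exists>d>0. \<forall>z'\<in>V. dist z' z < d \<longrightarrow> dist (q z') (q z) < e"
      using prox_point_nonexpansive[OF \<alpha> X \<psi> q q] by (auto simp: dist_norm intro: le_less_trans)
  qed
  have cont_\<psi>q: "continuous_on V (\<lambda>z. \<psi> (q z))"
    unfolding continuous_on_def
  proof
    fix z assume z: "z \<in> V"
    define lo where "lo z' = \<psi> (q z) - 1 / (2 * \<alpha>) * ((norm (q z' - z))\<^sup>2 - (norm (q z - z))\<^sup>2)" for z'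
    define hi where "hi z' = \<psi> (q z) + 1 / (2 * \<alpha>) * ((norm (q z - z'))\<^sup>2 - (norm (q z' - z'))\<^sup>2)" for z'
    have lim_q: "(q \<longlongrightarrow> q z) (at z within V)"
      using cont_q z by (simp add: continuous_on_def)
    have "(lo \<longlongrightarrow> \<psi> (q z) - 1 / (2 * \<alpha>) * ((norm (q z - z))\<^sup>2 - (norm (q z - z))\<^sup>2)) (at z within V)"
      unfolding lo_def by (intro tendsto_intros lim_q)
    then have lo_lim: "(lo \<longlongrightarrow> \<psi> (q z)) (at z within V)" by simp
    have "(hi \<longlongrightarrow> \<psi> (q z) + 1 / (2 * \<alpha>) * ((norm (q z - z))\<^sup>2 - (norm (q z - z))\<^sup>2)) (at z within V)"
      unfolding hi_def by (intro tendsto_intros lim_q)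
    then have hi_lim: "(hi \<longlongrightarrow> \<psi> (q z)) (at z within V)" by simp
    have lo_le: "lo z' \<le> \<psi> (q z')" if "z' \<in> V" for z'
    proof -
      have "1 / (2 * \<alpha>) * (norm (q z - z))\<^sup>2 + \<psi> (q z) \<le> 1 / (2 * \<alpha>) * (norm (q z' - z))\<^sup>2 + \<psi> (q z')"
        using q[OF z] q_in[OF that] unfolding prox_point_def is_arg_min_def by force
      then show ?thesis unfolding lo_def right_diff_distrib by linarith
    qed
    have hi_ge: "\<psi> (q z') \<le> hi z'" if "z' \<in> V" for z'
    proof -
      have "1 / (2 * \<alpha>) * (norm (q z' - z'))\<^sup>2 + \<psi> (q z') \<le> 1 / (2 * \<alpha>) * (norm (q z - z'))\<^sup>2 + \<psi> (q z)"
        using q[OF that] q_in[OF z] unfolding prox_point_def is_arg_min_def by force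
      then show ?thesis unfolding hi_def right_diff_distrib by linarith
    qed
    show "((\<lambda>z. \<psi> (q z)) \<longlongrightarrow> \<psi> (q z)) (at z within V)"
      by (rule tendsto_sandwich[OF _ _ lo_lim hi_lim])
        (auto simp: eventually_at_filter lo_le hi_ge)
  qed
  have v_V: "v \<in> measurable S (restrict_space borel V)"
    using v p by (intro measurable_restrict_space2) (auto simp: V_def)
  show "p \<in> borel_measurable S"
    using measurable_compose[OF v_V borel_measurable_continuous_on_restrict[OF cont_q]]
    by (rule measurable_cong[THEN iffD1, rotated]) (simp add: qv)
  show "(\<lambda>\<omega>. \<psi> (p \<omega>)) \<in> borel_measurable S"
    using measurable_compose[OF v_V borel_measurable_continuous_on_restrict[OF cont_\<psi>q]]
    by (rule measurable_cong[THEN iffD1, rotated]) (simp add: qv)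
qed


section \<open>Functions with a Lipschitz gradient\<close>

text \<open>
  The restriction of \<open>f\<close> to the segment from \<open>x\<close> to \<open>y\<close>, minus the claimed quadratic, has
  nonpositive derivative. The segment lies in \<open>X\<close>, so derivatives within \<open>X\<close> are enough. Comparing
  \<open>f\<close> with its tangents alone would lose a factor \<open>2\<close> in front of \<open>L\<close>, and with it the step sizes
  between \<open>1 / (2 * L)\<close> and \<open>1 / L\<close>.
\<close>

lemma lipschitz_gradient_upper_bound:
  fixes f :: "'a :: real_inner \<Rightarrow> real"
  assumes X: "convex X" and xy: "x \<in> X" "y \<in> X"
    and deriv: "\<And>u. u \<in> X \<Longrightarrow> (f has_derivative (\<lambda>h. f' u \<bullet> h)) (at u within X)"
    and lipschitz: "\<And>u w. u \<in> X \<Longrightarrow> w \<in> X \<Longrightarrow> norm (f' u - f' w) \<le> L * norm (u - w)"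
  shows "f y \<le> f x + f' x \<bullet> (y - x) + L / 2 * (norm (y - x))\<^sup>2"
proof -
  define d where "d = y - x"
  define h where "h s = f (x + s *\<^sub>R d) - s * (f' x \<bullet> d) - L / 2 * (norm d)\<^sup>2 * s\<^sup>2" for s :: real
  have seg: "x + s *\<^sub>R d \<in> X" if "0 \<le> s" "s \<le> 1" for s
  proof -
    have "x + s *\<^sub>R d = (1 - s) *\<^sub>R x + s *\<^sub>R y" by (simp add: d_def algebra_simps)
    then show ?thesis using X xy that by (simp add: convexD)
  qed
  have der: "(h has_derivative (\<lambda>r. r * (f' (x + s *\<^sub>R d) \<bullet> d - f' x \<bullet> d - L * (norm d)\<^sup>2 * s)))
      (at s within {0..1})" if "0 \<le> s" "s \<le> 1" for s
  proof -
    have "((\<lambda>s. x + s *\<^sub>R d) has_derivative (\<lambda>r. r *\<^sub>R d)) (at s within {0..1})"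
      by (auto intro!: derivative_eq_intros)
    moreover have "(f has_derivative (\<lambda>k. f' (x + s *\<^sub>R d) \<bullet> k))
        (at (x + s *\<^sub>R d) within (\<lambda>s. x + s *\<^sub>R d) ` {0..1})"
      by (rule has_derivative_subset[OF deriv[OF seg]]) (use that seg in auto)
    ultimately have "((\<lambda>s. f (x + s *\<^sub>R d)) has_derivative (\<lambda>r. f' (x + s *\<^sub>R d) \<bullet> (r *\<^sub>R d)))
        (at s within {0..1})"
      by (rule has_derivative_in_compose)
    then show ?thesis
      unfolding h_def
      by (auto intro!: derivative_eq_intros simp: algebra_simps power2_eq_square)
  qed
  obtain s where s: "s \<in> {0..1}"
    and eq: "h 1 - h 0 = (1 - 0) * (f' (x + s *\<^sub>R d) \<bullet> d - f' x \<bullet> d - L * (norm d)\<^sup>2 * s)"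
    using mvt_very_simple[of 0 1 h, OF _ der] by auto
  have "f' (x + s *\<^sub>R d) \<bullet> d - f' x \<bullet> d \<le> norm (f' (x + s *\<^sub>R d) - f' x) * norm d"
    by (metis inner_diff_left norm_cauchy_schwarz)
  also have "\<dots> \<le> (L * norm (s *\<^sub>R d)) * norm d"
    using lipschitz[OF seg \<open>x \<in> X\<close>, of s] s by (intro mult_right_mono) auto
  also have "\<dots> = L * (norm d)\<^sup>2 * s"
    using s by (simp add: power2_eq_square)
  finally have "h 1 \<le> h 0" using eq by simp
  then show ?thesis by (simp add: h_def d_def)
qed


section \<open>Integrating out an independent variable\<close>

lemma (in prob_space) indep_set_other_vars:
  assumes indep: "indep_vars N X I" and i: "i \<in> I"
  shows "indep_set
    (sigma_sets (space M) (\<Union>k\<in>I - {i}. {X k -` A \<inter> space M |A. A \<in> sets (N k)}))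
    (sigma_sets (space M) {X i -` A \<inter> space M |A. A \<in> sets (N i)})"
proof -
  define E where "E = (\<lambda>k. {X k -` A \<inter> space M |A. A \<in> sets (N k)})"
  define J where "J = case_bool (I - {i}) {i}"
  have "(\<Union>b. J b) = I"
    using i by (auto simp: J_def UNIV_bool)
  then have "indep_sets E (\<Union>b\<in>UNIV. J b)"
    using indep by (simp add: indep_vars_def2 E_def)
  moreover have "Int_stable (E k)" for k
    unfolding E_def
  proof (rule Int_stableI)
    fix A B
    assume "A \<in> {X k -` A \<inter> space M |A. A \<in> sets (N k)}" "B \<in> {X k -` A \<inter> space M |A. A \<in> sets (N k)}"
    then obtain A' B' where "A' \<in> sets (N k)" "B' \<in> sets (N k)"
      "A = X k -` A' \<inter> space M" "B = X k -` B' \<inter> space M" by auto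
    then show "A \<inter> B \<in> {X k -` A \<inter> space M |A. A \<in> sets (N k)}"
      by (auto intro!: exI[of _ "A' \<inter> B'"])
  qed
  moreover have "disjoint_family_on J UNIV"
    by (auto simp: disjoint_family_on_def J_def split: bool.splits)
  ultimately have "indep_sets (\<lambda>b. sigma_sets (space M) (\<Union>k\<in>J b. E k)) UNIV"
    by (intro indep_sets_collect_sigma) auto
  moreover have "(\<lambda>b. sigma_sets (space M) (\<Union>k\<in>J b. E k))
      = case_bool (sigma_sets (space M) (\<Union>k\<in>I - {i}. E k)) (sigma_sets (space M) (E i))"
    by (auto simp: J_def fun_eq_iff split: bool.splits)
  ultimately show ?thesis
    by (simp add: indep_set_def E_def)
qed

lemma (in prob_space) joint_distr_of_indep_set:
  assumes indep: "indep_set \<A> \<B>"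
    and Z: "random_variable S Z" and Y: "random_variable T Y"
    and Z_\<A>: "\<And>A. A \<in> sets S \<Longrightarrow> Z -` A \<inter> space M \<in> \<A>"
    and Y_\<B>: "\<And>B. B \<in> sets T \<Longrightarrow> Y -` B \<inter> space M \<in> \<B>"
  shows "distr M (S \<Otimes>\<^sub>M T) (\<lambda>\<omega>. (Z \<omega>, Y \<omega>)) = distr M S Z \<Otimes>\<^sub>M distr M T Y"
proof (rule pair_measure_eqI[symmetric])
  interpret S: prob_space "distr M S Z" using Z by (rule prob_space_distr)
  interpret T: prob_space "distr M T Y" using Y by (rule prob_space_distr)
  show "sigma_finite_measure (distr M S Z)" "sigma_finite_measure (distr M T Y)" ..
  fix A B assume AB: "A \<in> sets (distr M S Z)" "B \<in> sets (distr M T Y)"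
  have ZY: "random_variable (S \<Otimes>\<^sub>M T) (\<lambda>\<omega>. (Z \<omega>, Y \<omega>))"
    using Z Y by (rule measurable_Pair)
  have "(\<lambda>\<omega>. (Z \<omega>, Y \<omega>)) -` (A \<times> B) \<inter> space M = (Z -` A \<inter> space M) \<inter> (Y -` B \<inter> space M)"
    by auto
  then have "emeasure (distr M (S \<Otimes>\<^sub>M T) (\<lambda>\<omega>. (Z \<omega>, Y \<omega>))) (A \<times> B)
      = ennreal (prob ((Z -` A \<inter> space M) \<inter> (Y -` B \<inter> space M)))"
    using AB by (subst emeasure_distr[OF ZY]) (auto simp: emeasure_eq_measure)
  also have "\<dots> = ennreal (prob (Z -` A \<inter> space M)) * ennreal (prob (Y -` B \<inter> space M))"
    using indep_setD[OF indep Z_\<A> Y_\<B>] AB by (simp add: ennreal_mult)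
  also have "\<dots> = emeasure (distr M S Z) A * emeasure (distr M T Y) B"
    using AB Z Y by (simp add: emeasure_distr emeasure_eq_measure)
  finally show "emeasure (distr M S Z) A * emeasure (distr M T Y) B
      = emeasure (distr M (S \<Otimes>\<^sub>M T) (\<lambda>\<omega>. (Z \<omega>, Y \<omega>))) (A \<times> B)" ..
qed simp

text \<open>
  The product form of the joint distribution plays the role of conditioning: given the value of
  \<open>Z\<close>, the sample \<open>Y\<close> still has distribution \<open>P\<close> and can be integrated out first.
\<close>

lemma nn_integral_joint_distr:
  fixes K :: "'s \<times> 'b \<Rightarrow> ennreal"
  assumes joint: "distr M (S \<Otimes>\<^sub>M P) (\<lambda>\<omega>. (Z \<omega>, Y \<omega>)) = distr M S Z \<Otimes>\<^sub>M P"
    and P: "sigma_finite_measure P"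
    and Z[measurable]: "Z \<in> measurable M S" and Y[measurable]: "Y \<in> measurable M P"
    and K[measurable]: "K \<in> borel_measurable (S \<Otimes>\<^sub>M P)"
  shows "(\<integral>\<^sup>+\<omega>. K (Z \<omega>, Y \<omega>) \<partial>M) = (\<integral>\<^sup>+\<omega>. \<integral>\<^sup>+p. K (Z \<omega>, p) \<partial>P \<partial>M)"
proof -
  interpret P: sigma_finite_measure P by fact
  have "(\<integral>\<^sup>+\<omega>. K (Z \<omega>, Y \<omega>) \<partial>M) = (\<integral>\<^sup>+q. K q \<partial>distr M (S \<Otimes>\<^sub>M P) (\<lambda>\<omega>. (Z \<omega>, Y \<omega>)))"
    by (subst nn_integral_distr) auto
  also have "\<dots> = (\<integral>\<^sup>+z. \<integral>\<^sup>+p. K (z, p) \<partial>P \<partial>distr M S Z)"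
    unfolding joint by (subst P.nn_integral_fst) simp_all
  also have "\<dots> = (\<integral>\<^sup>+\<omega>. \<integral>\<^sup>+p. K (Z \<omega>, p) \<partial>P \<partial>M)"
    by (subst nn_integral_distr) (auto intro: P.borel_measurable_nn_integral_fst)
  finally show ?thesis .
qed

lemma (in prob_space) expectation_zero_joint_distr:
  fixes K :: "'s \<times> 'b \<Rightarrow> real"
  assumes joint: "distr M (S \<Otimes>\<^sub>M P) (\<lambda>\<omega>. (Z \<omega>, Y \<omega>)) = distr M S Z \<Otimes>\<^sub>M P"
    and P: "prob_space P"
    and Z[measurable]: "random_variable S Z" and Y[measurable]: "random_variable P Y"
    and K[measurable]: "K \<in> borel_measurable (S \<Otimes>\<^sub>M P)"
    and int: "integrable M (\<lambda>\<omega>. K (Z \<omega>, Y \<omega>))"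
    and zero: "\<And>z. z \<in> space S \<Longrightarrow> (\<integral>p. K (z, p) \<partial>P) = 0"
  shows "expectation (\<lambda>\<omega>. K (Z \<omega>, Y \<omega>)) = 0"
proof -
  interpret P: prob_space P by fact
  interpret Z: prob_space "distr M S Z"
    by (rule prob_space_distr) fact
  interpret ZP: pair_sigma_finite "distr M S Z" P ..
  have "integrable (distr M S Z \<Otimes>\<^sub>M P) K"
    unfolding joint[symmetric] using int by (subst integrable_distr_eq) auto
  then have "(\<integral>q. K q \<partial>(distr M S Z \<Otimes>\<^sub>M P)) = (\<integral>z. \<integral>p. K (z, p) \<partial>P \<partial>distr M S Z)"
    by (rule ZP.integral_fst'[symmetric])
  also have "\<dots> = (\<integral>z. 0 \<partial>distr M S Z)"
    using zero by (intro Bochner_Integration.integral_cong) auto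
  finally have "(\<integral>q. K q \<partial>distr M (S \<Otimes>\<^sub>M P) (\<lambda>\<omega>. (Z \<omega>, Y \<omega>))) = 0"
    by (simp add: joint)
  then show ?thesis
    by (subst (asm) integral_distr) auto
qed


section \<open>Iterates as functions of the samples\<close>

context stochastic_prox_gradient
begin

definition gradient_noise :: "nat \<Rightarrow> nat \<Rightarrow> 'w \<Rightarrow> 'a"
  where "gradient_noise t j \<omega> = gradF (x t \<omega>) (\<xi> t j \<omega>) - mean P gradF (x t \<omega>)"

definition batch_noise :: "nat \<Rightarrow> 'w \<Rightarrow> 'a"
  where "batch_noise t \<omega>
    = batch_gradient gradF N \<xi> t \<omega> (x t \<omega>) - mean P gradF (x t \<omega>)"

text \<open>
  Not only the earlier samples: that way both \<open>x t\<close> and the noises of the other members of batch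
  \<open>t\<close> are measurable, while \<open>\<xi> t j\<close> remains independent.
\<close>

definition other_samples :: "nat \<Rightarrow> nat \<Rightarrow> 'w measure"
  where "other_samples t j = sigma (space M)
    (\<Union>(s, i)\<in>{(s, i). 1 \<le> s \<and> 1 \<le> i \<and> i \<le> N s} - {(t, j)}.
      {\<xi> s i -` A \<inter> space M |A. A \<in> sets P})"

lemma batch_noise_eq:
  assumes "1 \<le> t"
  shows "batch_noise t \<omega> = (1 / real (N t)) *\<^sub>R (\<Sum>j = 1..N t. gradient_noise t j \<omega>)"
  using N_pos[OF assms]
  by (simp add: batch_noise_def batch_gradient_def gradient_noise_def sum_subtractf
      scaleR_right_diff_distrib scaleR_sum_left[symmetric] sum_constant_scaleR)

lemma iterate_in:
  assumes "1 \<le> t" "\<omega> \<in> space M"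
  shows "x t \<omega> \<in> X"
proof (cases "t = 1")
  case True
  then show ?thesis using x_init[OF assms(2)] x\<^sub>1_in by simp
next
  case False
  then have "1 \<le> t - 1" "t = (t - 1) + 1" using assms by auto
  then show ?thesis using x_step[of "t - 1" \<omega>] assms(2) by (simp add: is_arg_min_def)
qed

lemma iterate_prox_point:
  assumes "1 \<le> t" "\<omega> \<in> space M"
  shows "prox_point (\<alpha> t) X \<psi> (x t \<omega> - \<alpha> t *\<^sub>R batch_gradient gradF N \<xi> t \<omega> (x t \<omega>)) (x (t + 1) \<omega>)"
proof -
  define G where "G = batch_gradient gradF N \<xi> t \<omega> (x t \<omega>)"
  have "1 / (2 * \<alpha> t) * (norm (y - (x t \<omega> - \<alpha> t *\<^sub>R G)))\<^sup>2
      = G \<bullet> (y - x t \<omega>) + 1 / (2 * \<alpha> t) * (norm (y - x t \<omega>))\<^sup>2 + \<alpha> t / 2 * (norm G)\<^sup>2" for y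
    using prox_centre_shift \<alpha>_pos[OF assms(1)] .
  then show ?thesis
    using x_step[OF assms] unfolding prox_point_def is_arg_min_def G_def by simp
qed

lemma mean_gradient_measurable: "mean P gradF \<in> borel_measurable (restrict_space borel X)"
proof (rule borel_measurable_continuous_on_restrict)
  show "continuous_on X (mean P gradF)"
    unfolding continuous_on_iff
  proof (intro ballI allI impI)
    fix u e assume "u \<in> X" "(0::real) < e"
    then show "\<exists>d>0. \<forall>w\<in>X. dist w u < d \<longrightarrow> dist (mean P gradF w) (mean P gradF u) < e"
      using f_smooth L_pos
      by (intro exI[of _ "e / L"])
        (auto simp: dist_norm field_simps intro: le_less_trans)
  qed
qed

lemma mean_objective_measurable: "mean P F \<in> borel_measurable (restrict_space borel X)"
  using f_gradient
  by (intro borel_measurable_continuous_on_restrict has_derivative_continuous_on)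

lemma gradient_measurable:
  assumes "u \<in> measurable S (restrict_space borel X)" "q \<in> measurable S P"
  shows "(\<lambda>\<omega>. gradF (u \<omega>) (q \<omega>)) \<in> borel_measurable S"
  using measurable_compose[OF measurable_Pair[OF assms] gradF_measurable] by simp

text \<open>
  Stated for an arbitrary \<sigma>-algebra \<open>S\<close> that contains the earlier samples: it serves both for
  measurability with respect to \<open>M\<close> and for independence of the current samples.
\<close>

lemma iterate_measurable:
  assumes S: "space S = space M" and "1 \<le> t"
    and \<xi>: "\<And>s i. 1 \<le> s \<Longrightarrow> s < t \<Longrightarrow> 1 \<le> i \<Longrightarrow> i \<le> N s \<Longrightarrow> \<xi> s i \<in> measurable S P"
  shows "x t \<in> measurable S (restrict_space borel X)"
  using \<open>1 \<le> t\<close> \<xi>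
proof (induction t rule: nat_induct_at_least)
  case base
  have "x 1 \<in> measurable S (restrict_space borel X) \<longleftrightarrow> (\<lambda>_. x\<^sub>1) \<in> measurable S (restrict_space borel X)"
    by (rule measurable_cong) (simp add: S x_init del: One_nat_def)
  then show ?case using x\<^sub>1_in by (simp add: measurable_restrict_space2_iff del: One_nat_def)
next
  case (Suc t)
  have xt: "x t \<in> measurable S (restrict_space borel X)"
    using Suc by simp
  have "(\<lambda>\<omega>. batch_gradient gradF N \<xi> t \<omega> (x t \<omega>)) \<in> borel_measurable S"
    unfolding batch_gradient_def
    using gradient_measurable[OF xt Suc.prems] Suc.hyps
    by (intro borel_measurable_scaleR borel_measurable_const borel_measurable_sum) auto
  moreover have "x t \<in> borel_measurable S"
    using xt by (simp add: measurable_restrict_space2_iff)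
  ultimately have "(\<lambda>\<omega>. x t \<omega> - \<alpha> t *\<^sub>R batch_gradient gradF N \<xi> t \<omega> (x t \<omega>)) \<in> borel_measurable S"
    by measurable
  then have "x (t + 1) \<in> borel_measurable S"
    by (rule measurable_prox_point(1)[OF \<alpha>_pos[OF Suc.hyps] convex_X \<psi>_convex])
      (use iterate_prox_point[OF Suc.hyps] S in simp)
  then show ?case
    using iterate_in[of "Suc t"] S by (auto simp: measurable_restrict_space2_iff)
qed

lemma sample_measurable:
  assumes "1 \<le> t" "1 \<le> j" "j \<le> N t"
  shows "\<xi> t j \<in> measurable M P"
proof -
  interpret prob_space M by (rule prob_M)
  have "indep_vars (\<lambda>_. P) (\<lambda>(t, j). \<xi> t j) {(t, j). 1 \<le> t \<and> 1 \<le> j \<and> j \<le> N t}"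
    using samples by (simp add: iid_samples_def)
  then have "random_variable P ((\<lambda>(t, j). \<xi> t j) (t, j))"
    unfolding indep_vars_def2 using assms by blast
  then show ?thesis by simp
qed

lemma iterate_measurable_M: "1 \<le> t \<Longrightarrow> x t \<in> measurable M (restrict_space borel X)"
  using sample_measurable by (intro iterate_measurable) auto

lemma iterate_borel_measurable: "1 \<le> t \<Longrightarrow> x t \<in> borel_measurable M"
  using iterate_measurable_M by (simp add: measurable_restrict_space2_iff)

lemma objective_iterate_measurable:
  assumes "1 \<le> t"
  shows "(\<lambda>\<omega>. objective P F \<psi> (x (t + 1) \<omega>)) \<in> borel_measurable M"
proof -
  have "(\<lambda>\<omega>. batch_gradient gradF N \<xi> t \<omega> (x t \<omega>)) \<in> borel_measurable M"
    unfolding batch_gradient_def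
    using gradient_measurable[OF iterate_measurable_M sample_measurable] assms
    by (intro borel_measurable_scaleR borel_measurable_const borel_measurable_sum) auto
  then have "(\<lambda>\<omega>. x t \<omega> - \<alpha> t *\<^sub>R batch_gradient gradF N \<xi> t \<omega> (x t \<omega>)) \<in> borel_measurable M"
    using iterate_borel_measurable[OF assms] by measurable
  then have "(\<lambda>\<omega>. \<psi> (x (t + 1) \<omega>)) \<in> borel_measurable M"
    by (rule measurable_prox_point(2)[OF \<alpha>_pos[OF assms] convex_X \<psi>_convex])
      (use iterate_prox_point[OF assms] in simp)
  moreover have "(\<lambda>\<omega>. mean P F (x (t + 1) \<omega>)) \<in> borel_measurable M"
    using measurable_compose[OF iterate_measurable_M mean_objective_measurable] by simp
  ultimately show ?thesis unfolding objective_def by measurable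
qed

lemma space_other_samples [simp]: "space (other_samples t j) = space M"
  by (simp add: other_samples_def space_measure_of_conv)

lemma sets_other_samples:
  "sets (other_samples t j) = sigma_sets (space M)
    (\<Union>(s, i)\<in>{(s, i). 1 \<le> s \<and> 1 \<le> i \<and> i \<le> N s} - {(t, j)}.
      {\<xi> s i -` A \<inter> space M |A. A \<in> sets P})"
  unfolding other_samples_def by (rule sets_measure_of) auto

lemma sample_measurable_other_samples:
  assumes "1 \<le> s" "1 \<le> i" "i \<le> N s" "(s, i) \<noteq> (t, j)"
  shows "\<xi> s i \<in> measurable (other_samples t j) P"
proof (rule measurableI)
  show "\<xi> s i \<omega> \<in> space P" if "\<omega> \<in> space (other_samples t j)" for \<omega>
    using measurable_space[OF sample_measurable] assms that by simp
  show "\<xi> s i -` A \<inter> space (other_samples t j) \<in> sets (other_samples t j)" if "A \<in> sets P" for A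
    unfolding sets_other_samples space_other_samples
    by (rule sigma_sets.Basic) (use assms that in blast)
qed

lemma measurable_other_samples_imp:
  assumes "U \<in> measurable (other_samples t j) S"
  shows "U \<in> measurable M S"
proof -
  have "sets (other_samples t j) \<subseteq> sets M"
    unfolding sets_other_samples
    using measurable_sets[OF sample_measurable]
    by (intro sets.sigma_sets_subset) auto
  then show ?thesis
    using assms unfolding measurable_def by auto
qed

lemma iterate_measurable_other_samples:
  "1 \<le> t \<Longrightarrow> x t \<in> measurable (other_samples t j) (restrict_space borel X)"
  using sample_measurable_other_samples by (intro iterate_measurable) auto

lemma gradient_noise_measurable:
  assumes "x t \<in> measurable S (restrict_space borel X)" "\<xi> t j \<in> measurable S P"
  shows "gradient_noise t j \<in> borel_measurable S"
  using gradient_measurable[OF assms] measurable_compose[OF assms(1) mean_gradient_measurable]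
  unfolding gradient_noise_def by measurable

lemma sample_joint_distr:
  assumes tj: "1 \<le> t" "1 \<le> j" "j \<le> N t"
    and U: "U \<in> measurable (other_samples t j) S"
  shows "distr M (S \<Otimes>\<^sub>M P) (\<lambda>\<omega>. (U \<omega>, \<xi> t j \<omega>)) = distr M S U \<Otimes>\<^sub>M P"
proof -
  interpret prob_space M by (rule prob_M)
  let ?I = "{(t, j). 1 \<le> t \<and> 1 \<le> j \<and> j \<le> N t}"
  have "indep_vars (\<lambda>_. P) (\<lambda>(t, j). \<xi> t j) ?I" "distr M P (\<xi> t j) = P"
    using samples tj by (auto simp: iid_samples_def)
  moreover from this have "indep_set (sets (other_samples t j))
      (sigma_sets (space M) {\<xi> t j -` A \<inter> space M |A. A \<in> sets P})"
    using indep_set_other_vars[of "\<lambda>_. P" "\<lambda>(t, j). \<xi> t j" ?I "(t, j)"] tj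
    by (simp add: sets_other_samples case_prod_unfold)
  then have "distr M (S \<Otimes>\<^sub>M P) (\<lambda>\<omega>. (U \<omega>, \<xi> t j \<omega>)) = distr M S U \<Otimes>\<^sub>M distr M P (\<xi> t j)"
    using measurable_other_samples_imp[OF U] sample_measurable[OF tj]
  proof (rule joint_distr_of_indep_set)
    show "U -` A \<inter> space M \<in> sets (other_samples t j)" if "A \<in> sets S" for A
      using measurable_sets[OF U that] by simp
    show "\<xi> t j -` B \<inter> space M \<in> sigma_sets (space M) {\<xi> t j -` A \<inter> space M |A. A \<in> sets P}"
      if "B \<in> sets P" for B
      by (rule sigma_sets.Basic) (use that in blast)
  qed
  ultimately show ?thesis by simp
qed


section \<open>Moments of the batch noise\<close>

lemma nn_integral_gradient_noise:
  assumes tj: "1 \<le> t" "1 \<le> j" "j \<le> N t"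
  shows "(\<integral>\<^sup>+\<omega>. ennreal ((norm (gradient_noise t j \<omega>))\<^sup>2) \<partial>M)
    = (\<integral>\<^sup>+\<omega>. \<integral>\<^sup>+p. ennreal ((norm (gradF (x t \<omega>) p - mean P gradF (x t \<omega>)))\<^sup>2) \<partial>P \<partial>M)"
proof -
  let ?S = "restrict_space borel X"
  define K where "K = (\<lambda>(u, p). ennreal ((norm (gradF u p - mean P gradF u))\<^sup>2))"
  have "(\<lambda>z. mean P gradF (fst z)) \<in> borel_measurable (?S \<Otimes>\<^sub>M P)"
    by (rule measurable_compose[OF measurable_fst mean_gradient_measurable])
  then have K: "K \<in> borel_measurable (?S \<Otimes>\<^sub>M P)"
    using gradF_measurable unfolding K_def case_prod_unfold by measurable
  show ?thesis
    using nn_integral_joint_distr[OF sample_joint_distr[OF tj iterate_measurable_other_samples]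
        prob_space_imp_sigma_finite[OF prob_P] iterate_measurable_M sample_measurable[OF tj] K] tj
    by (simp add: K_def gradient_noise_def)
qed

text \<open>
  Conditionally on all other samples, \<open>W\<close> is a constant and the noise of the \<open>j\<close>-th sample has
  mean zero.
\<close>

lemma gradient_noise_orthogonal:
  assumes tj: "1 \<le> t" "1 \<le> j" "j \<le> N t"
    and W: "W \<in> borel_measurable (other_samples t j)"
    and W2: "integrable M (\<lambda>\<omega>. (norm (W \<omega>))\<^sup>2)"
    and noise2: "integrable M (\<lambda>\<omega>. (norm (gradient_noise t j \<omega>))\<^sup>2)"
  shows "integrable M (\<lambda>\<omega>. gradient_noise t j \<omega> \<bullet> W \<omega>)"
    and "(\<integral>\<omega>. gradient_noise t j \<omega> \<bullet> W \<omega> \<partial>M) = 0"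
proof -
  interpret prob_space M by (rule prob_M)
  interpret P: prob_space P by (rule prob_P)
  let ?R = "restrict_space borel X"
  let ?S = "?R \<Otimes>\<^sub>M borel"
  have [measurable]: "W \<in> borel_measurable M"
    using W by (rule measurable_other_samples_imp)
  have [measurable]: "gradient_noise t j \<in> borel_measurable M"
    using gradient_noise_measurable iterate_measurable_M sample_measurable tj by simp
  show int: "integrable M (\<lambda>\<omega>. gradient_noise t j \<omega> \<bullet> W \<omega>)"
  proof (rule Bochner_Integration.integrable_bound)
    show "integrable M (\<lambda>\<omega>. (norm (gradient_noise t j \<omega>))\<^sup>2 + (norm (W \<omega>))\<^sup>2)"
      using noise2 W2 by simp
    show "AE \<omega> in M. norm (gradient_noise t j \<omega> \<bullet> W \<omega>)
        \<le> norm ((norm (gradient_noise t j \<omega>))\<^sup>2 + (norm (W \<omega>))\<^sup>2)"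
    proof (rule AE_I2)
      fix \<omega>
      let ?a = "norm (gradient_noise t j \<omega>)" and ?b = "norm (W \<omega>)"
      have "\<bar>gradient_noise t j \<omega> \<bullet> W \<omega>\<bar> \<le> ?a * ?b"
        by (rule Cauchy_Schwarz_ineq2)
      also have "\<dots> \<le> ?a\<^sup>2 + ?b\<^sup>2"
        using sum_squares_bound[of ?a ?b] mult_nonneg_nonneg[OF norm_ge_zero norm_ge_zero, of "gradient_noise t j \<omega>" "W \<omega>"]
        by linarith
      finally show "norm (gradient_noise t j \<omega> \<bullet> W \<omega>) \<le> norm (?a\<^sup>2 + ?b\<^sup>2)" by simp
    qed
  qed measurable
  define K where "K = (\<lambda>((u, w), p). (gradF u p - mean P gradF u) \<bullet> (w :: 'a))"
  have U: "(\<lambda>\<omega>. (x t \<omega>, W \<omega>)) \<in> measurable (other_samples t j) ?S"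
    using iterate_measurable_other_samples W tj by (intro measurable_Pair) auto
  have 1: "(\<lambda>z. mean P gradF (fst (fst z))) \<in> borel_measurable (?S \<Otimes>\<^sub>M P)"
    by (rule measurable_compose[OF _ mean_gradient_measurable]) measurable
  have 2: "(\<lambda>z. gradF (fst (fst z)) (snd z)) \<in> borel_measurable (?S \<Otimes>\<^sub>M P)"
    by (rule gradient_measurable) measurable
  have K: "K \<in> borel_measurable (?S \<Otimes>\<^sub>M P)"
    using 1 2 unfolding K_def case_prod_unfold by measurable
  have zero: "(\<integral>p. K (z, p) \<partial>P) = 0" if z: "z \<in> space ?S" for z
  proof -
    obtain u w where zuw: "z = (u, w)" "u \<in> X"
      using z by (auto simp: space_pair_measure space_restrict_space)
    then have "(\<integral>p. K (z, p) \<partial>P) = (\<integral>p. gradF u p - mean P gradF u \<partial>P) \<bullet> w"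
      using gradF_integrable by (simp add: K_def)
    also have "(\<integral>p. gradF u p - mean P gradF u \<partial>P) = 0"
      using gradF_integrable zuw by (simp add: mean_def P.prob_space)
    finally show ?thesis by simp
  qed
  show "(\<integral>\<omega>. gradient_noise t j \<omega> \<bullet> W \<omega> \<partial>M) = 0"
    using expectation_zero_joint_distr[OF sample_joint_distr[OF tj U] prob_P
        measurable_other_samples_imp[OF U] sample_measurable[OF tj] K _ zero] int
    by (simp add: K_def gradient_noise_def)
qed

text \<open>
  The noises of one batch are pairwise orthogonal, so the second moment of their average is
  smaller than that of a single one by the factor \<open>N t\<close>.
\<close>

lemma batch_noise_second_moment:
  assumes t: "1 \<le> t"
    and noise2: "\<And>j. 1 \<le> j \<Longrightarrow> j \<le> N t \<Longrightarrow> integrable M (\<lambda>\<omega>. (norm (gradient_noise t j \<omega>))\<^sup>2)"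
    and bound: "\<And>j. 1 \<le> j \<Longrightarrow> j \<le> N t \<Longrightarrow> (\<integral>\<omega>. (norm (gradient_noise t j \<omega>))\<^sup>2 \<partial>M) \<le> B"
  shows "integrable M (\<lambda>\<omega>. (norm (batch_noise t \<omega>))\<^sup>2)"
    and "(\<integral>\<omega>. (norm (batch_noise t \<omega>))\<^sup>2 \<partial>M) \<le> B / real (N t)"
proof -
  let ?J = "{1..N t}"
  have sq: "(norm (batch_noise t \<omega>))\<^sup>2
      = (1 / real (N t))\<^sup>2 * (\<Sum>j\<in>?J. \<Sum>k\<in>?J. gradient_noise t j \<omega> \<bullet> gradient_noise t k \<omega>)" for \<omega>
    unfolding power2_norm_eq_inner batch_noise_eq[OF t] inner_scaleR_left inner_scaleR_right
      inner_sum_left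
    unfolding inner_sum_right by (simp add: power2_eq_square)
  have off: "integrable M (\<lambda>\<omega>. gradient_noise t j \<omega> \<bullet> gradient_noise t k \<omega>)"
      "(\<integral>\<omega>. gradient_noise t j \<omega> \<bullet> gradient_noise t k \<omega> \<partial>M) = 0"
    if "j \<in> ?J" "k \<in> ?J" "j \<noteq> k" for j k
    using that t noise2
    by (auto intro!: gradient_noise_orthogonal gradient_noise_measurable
        iterate_measurable_other_samples sample_measurable_other_samples)
  have pair_int: "integrable M (\<lambda>\<omega>. gradient_noise t j \<omega> \<bullet> gradient_noise t k \<omega>)"
    if "j \<in> ?J" "k \<in> ?J" for j k
    using that off noise2 by (cases "j = k") (auto simp: power2_norm_eq_inner)
  have row_int: "integrable M (\<lambda>\<omega>. \<Sum>k\<in>?J. gradient_noise t j \<omega> \<bullet> gradient_noise t k \<omega>)" if "j \<in> ?J" for j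
    by (rule Bochner_Integration.integrable_sum) (rule pair_int[OF that])
  show "integrable M (\<lambda>\<omega>. (norm (batch_noise t \<omega>))\<^sup>2)"
    unfolding sq by (intro integrable_mult_right Bochner_Integration.integrable_sum row_int)
  have "(\<integral>\<omega>. (\<Sum>j\<in>?J. \<Sum>k\<in>?J. gradient_noise t j \<omega> \<bullet> gradient_noise t k \<omega>) \<partial>M)
      = (\<Sum>j\<in>?J. \<integral>\<omega>. (\<Sum>k\<in>?J. gradient_noise t j \<omega> \<bullet> gradient_noise t k \<omega>) \<partial>M)"
    by (rule Bochner_Integration.integral_sum) (rule row_int)
  also have "\<dots> = (\<Sum>j\<in>?J. \<Sum>k\<in>?J. (\<integral>\<omega>. gradient_noise t j \<omega> \<bullet> gradient_noise t k \<omega> \<partial>M))"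
    by (intro sum.cong refl Bochner_Integration.integral_sum pair_int)
  finally have "(\<integral>\<omega>. (norm (batch_noise t \<omega>))\<^sup>2 \<partial>M) = (1 / real (N t))\<^sup>2 *
      (\<Sum>j\<in>?J. \<Sum>k\<in>?J. (\<integral>\<omega>. gradient_noise t j \<omega> \<bullet> gradient_noise t k \<omega> \<partial>M))"
    unfolding sq by simp
  also have "(\<Sum>j\<in>?J. \<Sum>k\<in>?J. (\<integral>\<omega>. gradient_noise t j \<omega> \<bullet> gradient_noise t k \<omega> \<partial>M))
      = (\<Sum>j\<in>?J. \<Sum>k\<in>?J. if k = j then (\<integral>\<omega>. (norm (gradient_noise t j \<omega>))\<^sup>2 \<partial>M) else 0)"
    using off(2) by (intro sum.cong refl) (auto simp: power2_norm_eq_inner)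
  also have "\<dots> = (\<Sum>j\<in>?J. (\<integral>\<omega>. (norm (gradient_noise t j \<omega>))\<^sup>2 \<partial>M))"
    by simp
  also have "(1 / real (N t))\<^sup>2 * \<dots> \<le> (1 / real (N t))\<^sup>2 * (\<Sum>j\<in>?J. B)"
    using bound by (intro mult_left_mono sum_mono) auto
  also have "\<dots> = B / real (N t)"
    using N_pos[OF t] by (simp add: power2_eq_square)
  finally show "(\<integral>\<omega>. (norm (batch_noise t \<omega>))\<^sup>2 \<partial>M) \<le> B / real (N t)" .
qed

lemma batch_noise_orthogonal:
  assumes t: "1 \<le> t"
    and noise2: "\<And>j. 1 \<le> j \<Longrightarrow> j \<le> N t \<Longrightarrow> integrable M (\<lambda>\<omega>. (norm (gradient_noise t j \<omega>))\<^sup>2)"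
    and dist2: "integrable M (\<lambda>\<omega>. (norm (x t \<omega> - y))\<^sup>2)"
  shows "integrable M (\<lambda>\<omega>. batch_noise t \<omega> \<bullet> (x t \<omega> - y))"
    and "(\<integral>\<omega>. batch_noise t \<omega> \<bullet> (x t \<omega> - y) \<partial>M) = 0"
proof -
  have W: "(\<lambda>\<omega>. x t \<omega> - y) \<in> borel_measurable (other_samples t j)" for j
  proof -
    have "x t \<in> borel_measurable (other_samples t j)"
      using iterate_measurable_other_samples[OF t, of j] by (simp add: measurable_restrict_space2_iff)
    then show ?thesis by measurable
  qed
  have eq: "batch_noise t \<omega> \<bullet> (x t \<omega> - y)
      = 1 / real (N t) * (\<Sum>j = 1..N t. gradient_noise t j \<omega> \<bullet> (x t \<omega> - y))" for \<omega>
    by (simp add: batch_noise_eq[OF t] inner_sum_left)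
  note single = gradient_noise_orthogonal[OF t _ _ W dist2 noise2]
  show "integrable M (\<lambda>\<omega>. batch_noise t \<omega> \<bullet> (x t \<omega> - y))"
    unfolding eq using single(1) by (intro integrable_mult_right Bochner_Integration.integrable_sum) auto
  show "(\<integral>\<omega>. batch_noise t \<omega> \<bullet> (x t \<omega> - y) \<partial>M) = 0"
    unfolding eq using single by simp
qed

end

text \<open>
  Finiteness at a single point spreads to all of \<open>X\<close> by the Lipschitz bound; squaring that bound
  costs the factor \<open>2\<close> from \<open>(a + b)\<^sup>2 \<le> 2 * a\<^sup>2 + 2 * b\<^sup>2\<close>.
\<close>

lemma noise_second_moment_le:
  assumes noise: "multiplicative_noise P X G \<sigma>\<^sub>L" and "u \<in> X" "y \<in> X"
  shows "(\<integral>\<^sup>+p. ennreal ((norm (G u p - mean P G u))\<^sup>2) \<partial>P)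
    \<le> ennreal (2 * (enn2real (noise_sd P G y))\<^sup>2 + 2 * \<sigma>\<^sub>L\<^sup>2 * (norm (u - y))\<^sup>2)"
proof -
  define v where "v = (\<integral>\<^sup>+p. ennreal ((norm (G u p - mean P G u))\<^sup>2) \<partial>P)"
  define s where "s = enn2real (noise_sd P G y)"
  have \<sigma>: "\<sigma>\<^sub>L > 0" using noise by (simp add: multiplicative_noise_def)
  have "0 \<le> s" by (simp add: s_def)
  have lip: "noise_sd P G z \<le> noise_sd P G w + ennreal (\<sigma>\<^sub>L * norm (z - w))"
    if "z \<in> X" "w \<in> X" for z w
    using noise that by (simp add: multiplicative_noise_def)
  obtain x0 where "x0 \<in> X" "noise_sd P G x0 < \<infinity>"
    using noise by (auto simp: multiplicative_noise_def)
  then have fin: "noise_sd P G z < \<infinity>" if "z \<in> X" for z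
    using lip[OF that \<open>x0 \<in> X\<close>] by (simp add: ennreal_add_less_top order.strict_trans1)
  then have fin_y: "noise_sd P G y = ennreal s" and fin_u: "noise_sd P G u \<noteq> \<infinity>"
    using fin[OF assms(2)] fin[OF assms(3)] by (auto simp: s_def)
  from fin_u have v_fin: "v \<noteq> \<infinity>" and sd: "noise_sd P G u = ennreal (sqrt (enn2real v))"
    unfolding noise_sd_def v_def[symmetric] by (auto simp: Let_def split: if_splits)
  have "ennreal (sqrt (enn2real v)) \<le> ennreal (s + \<sigma>\<^sub>L * norm (u - y))"
    using lip[OF assms(2,3)] \<sigma> \<open>0 \<le> s\<close> unfolding sd fin_y by simp
  then have "sqrt (enn2real v) \<le> s + \<sigma>\<^sub>L * norm (u - y)"
  proof (rule ennreal_le_iff[THEN iffD1, rotated])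
    show "0 \<le> s + \<sigma>\<^sub>L * norm (u - y)" using \<sigma> \<open>0 \<le> s\<close> by simp
  qed
  then have "enn2real v \<le> (s + \<sigma>\<^sub>L * norm (u - y))\<^sup>2"
    by (rule sqrt_le_D)
  also have "\<dots> \<le> 2 * s\<^sup>2 + 2 * \<sigma>\<^sub>L\<^sup>2 * (norm (u - y))\<^sup>2"
    using sum_squares_bound[of s "\<sigma>\<^sub>L * norm (u - y)"]
    by (simp add: power2_sum power_mult_distrib)
  finally have "ennreal (enn2real v) \<le> ennreal (2 * s\<^sup>2 + 2 * \<sigma>\<^sub>L\<^sup>2 * (norm (u - y))\<^sup>2)"
    by (rule ennreal_leI)
  then show ?thesis using v_fin by (simp add: v_def[symmetric] s_def less_top)
qed


section \<open>One step of the method\<close>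

context stochastic_prox_gradient
begin

text \<open>
  Adding the three-point inequality of the prox step, the quadratic upper bound for \<open>f\<close> from
  \<open>x t\<close> to \<open>x (t + 1)\<close> and strong convexity from \<open>x t\<close> to \<open>y\<close> cancels the mean gradient. The
  remaining noise term is split at \<open>x t\<close>: the part along \<open>x t - y\<close> has mean zero, and the part
  along \<open>x (t + 1) - x t\<close>, which is correlated with the noise, is absorbed by Young's inequality
  into the negative multiple of the squared step length that \<open>\<alpha> t * L < 1\<close> leaves over.
\<close>

lemma one_step:
  assumes t: "1 \<le> t" and \<omega>: "\<omega> \<in> space M" and y: "y \<in> X" and \<alpha>L: "\<alpha> t * L < 1"
  shows "objective P F \<psi> (x (t + 1) \<omega>) - objective P F \<psi> y
      + 1 / (2 * \<alpha> t) * (norm (x (t + 1) \<omega> - y))\<^sup>2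
    \<le> (1 / \<alpha> t - c) / 2 * (norm (x t \<omega> - y))\<^sup>2
      + \<alpha> t / (2 * (1 - \<alpha> t * L)) * (norm (batch_noise t \<omega>))\<^sup>2
      - batch_noise t \<omega> \<bullet> (x t \<omega> - y)"
proof -
  define u where "u = x t \<omega>"
  define w where "w = x (t + 1) \<omega>"
  define e where "e = batch_noise t \<omega>"
  define G where "G = batch_gradient gradF N \<xi> t \<omega> u"
  define a where "a = 1 / (2 * \<alpha> t)"
  define k where "k = a - L / 2"
  have \<alpha>: "\<alpha> t > 0" using \<alpha>_pos[OF t] .
  have "u \<in> X" "w \<in> X"
    using iterate_in t \<omega> by (auto simp: u_def w_def)
  have G: "G = mean P gradF u + e"
    by (simp add: G_def e_def u_def batch_noise_def)
  have shift: "a * (norm (z - (u - \<alpha> t *\<^sub>R G)))\<^sup>2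
      = G \<bullet> (z - u) + a * (norm (z - u))\<^sup>2 + \<alpha> t / 2 * (norm G)\<^sup>2" for z
    using \<alpha> prox_centre_shift by (simp add: a_def)
  have prox: "G \<bullet> (w - u) + a * (norm (w - u))\<^sup>2 + \<psi> w + a * (norm (w - y))\<^sup>2
      \<le> G \<bullet> (y - u) + a * (norm (y - u))\<^sup>2 + \<psi> y"
    using prox_point_three_point[OF \<alpha> convex_X \<psi>_convex iterate_prox_point[OF t \<omega>] y]
    unfolding a_def[symmetric] u_def[symmetric] w_def[symmetric]
    unfolding G_def[symmetric] shift
    by (simp add: norm_minus_commute)
  have descent: "mean P F w
      \<le> mean P F u + mean P gradF u \<bullet> (w - u) + L / 2 * (norm (w - u))\<^sup>2"
    using lipschitz_gradient_upper_bound[OF convex_X \<open>u \<in> X\<close> \<open>w \<in> X\<close> f_gradient f_smooth] .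
  have strong: "mean P F u + mean P gradF u \<bullet> (y - u) + c / 2 * (norm (y - u))\<^sup>2 \<le> mean P F y"
    using f_strongly_convex[OF \<open>u \<in> X\<close> y] .
  have "objective P F \<psi> w - objective P F \<psi> y + a * (norm (w - y))\<^sup>2
      \<le> (a - c / 2) * (norm (y - u))\<^sup>2 + e \<bullet> (y - u) - e \<bullet> (w - u) - k * (norm (w - u))\<^sup>2"
    using prox descent strong
    by (simp add: objective_def G k_def inner_add_left algebra_simps)
  moreover have "- (e \<bullet> (w - u)) - k * (norm (w - u))\<^sup>2 \<le> 1 / (4 * k) * (norm e)\<^sup>2"
  proof -
    have "k > 0" using \<alpha> \<alpha>L by (simp add: k_def a_def field_simps)
    \<comment> \<open>The square vanishes at the step \<open>w - u\<close> that maximizes the left-hand side.\<close>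
    have "0 \<le> (norm (e + (2 * k) *\<^sub>R (w - u)))\<^sup>2 / (4 * k)"
      using \<open>k > 0\<close> by simp
    also have "(norm (e + (2 * k) *\<^sub>R (w - u)))\<^sup>2
        = (norm e)\<^sup>2 + 4 * k * (e \<bullet> (w - u)) + 4 * k\<^sup>2 * (norm (w - u))\<^sup>2"
      unfolding power2_norm_eq_inner
      by (simp add: inner_add_left inner_add_right inner_commute power2_eq_square)
    also have "\<dots> / (4 * k) = 1 / (4 * k) * (norm e)\<^sup>2 + e \<bullet> (w - u) + k * (norm (w - u))\<^sup>2"
      using \<open>k > 0\<close> by (simp add: field_simps power2_eq_square)
    finally show ?thesis by simp
  qed
  moreover have "1 / (4 * k) = \<alpha> t / (2 * (1 - \<alpha> t * L))"
    using \<alpha> \<alpha>L by (simp add: k_def a_def field_simps)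
  moreover have "e \<bullet> (y - u) = - (e \<bullet> (u - y))"
    by (simp add: inner_diff_right)
  moreover have "a - c / 2 = (1 / \<alpha> t - c) / 2"
    by (simp add: a_def field_simps)
  ultimately have "objective P F \<psi> w - objective P F \<psi> y + a * (norm (w - y))\<^sup>2
      \<le> (1 / \<alpha> t - c) / 2 * (norm (u - y))\<^sup>2
        + \<alpha> t / (2 * (1 - \<alpha> t * L)) * (norm e)\<^sup>2 - e \<bullet> (u - y)"
    by (simp add: norm_minus_commute)
  then show ?thesis
    by (simp add: u_def w_def e_def a_def)
qed

lemma gradient_noise_second_moment:
  assumes noise: "multiplicative_noise P X gradF \<sigma>\<^sub>L"
    and tj: "1 \<le> t" "1 \<le> j" "j \<le> N t" and y: "y \<in> X"
    and dist2: "integrable M (\<lambda>\<omega>. (norm (x t \<omega> - y))\<^sup>2)"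
  shows "integrable M (\<lambda>\<omega>. (norm (gradient_noise t j \<omega>))\<^sup>2)"
    and "(\<integral>\<omega>. (norm (gradient_noise t j \<omega>))\<^sup>2 \<partial>M)
      \<le> 2 * (enn2real (noise_sd P gradF y))\<^sup>2 + 2 * \<sigma>\<^sub>L\<^sup>2 * (\<integral>\<omega>. (norm (x t \<omega> - y))\<^sup>2 \<partial>M)"
proof -
  interpret prob_space M by (rule prob_M)
  define s where "s = enn2real (noise_sd P gradF y)"
  have [measurable]: "gradient_noise t j \<in> borel_measurable M"
    using gradient_noise_measurable iterate_measurable_M sample_measurable tj by simp
  let ?bound = "2 * s\<^sup>2 + 2 * \<sigma>\<^sub>L\<^sup>2 * (\<integral>\<omega>. (norm (x t \<omega> - y))\<^sup>2 \<partial>M)"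
  have "(\<integral>\<^sup>+\<omega>. ennreal ((norm (gradient_noise t j \<omega>))\<^sup>2) \<partial>M)
      \<le> (\<integral>\<^sup>+\<omega>. ennreal (2 * s\<^sup>2 + 2 * \<sigma>\<^sub>L\<^sup>2 * (norm (x t \<omega> - y))\<^sup>2) \<partial>M)"
    unfolding nn_integral_gradient_noise[OF tj] s_def
    using noise_second_moment_le[OF noise iterate_in y] tj by (intro nn_integral_mono) auto
  also have "\<dots> = ennreal (\<integral>\<omega>. 2 * s\<^sup>2 + 2 * \<sigma>\<^sub>L\<^sup>2 * (norm (x t \<omega> - y))\<^sup>2 \<partial>M)"
    using dist2 by (intro nn_integral_eq_integral) auto
  also have "(\<integral>\<omega>. 2 * s\<^sup>2 + 2 * \<sigma>\<^sub>L\<^sup>2 * (norm (x t \<omega> - y))\<^sup>2 \<partial>M) = ?bound"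
    using dist2 by (simp add: prob_space)
  finally have le: "(\<integral>\<^sup>+\<omega>. ennreal ((norm (gradient_noise t j \<omega>))\<^sup>2) \<partial>M) \<le> ennreal ?bound" .
  show int: "integrable M (\<lambda>\<omega>. (norm (gradient_noise t j \<omega>))\<^sup>2)"
    using le by (intro integrableI_bounded) (auto simp: le_less_trans)
  then have "ennreal (\<integral>\<omega>. (norm (gradient_noise t j \<omega>))\<^sup>2 \<partial>M) \<le> ennreal ?bound"
    using le by (simp add: nn_integral_eq_integral)
  then show "(\<integral>\<omega>. (norm (gradient_noise t j \<omega>))\<^sup>2 \<partial>M) \<le> 2 * (enn2real (noise_sd P gradF y))\<^sup>2
      + 2 * \<sigma>\<^sub>L\<^sup>2 * (\<integral>\<omega>. (norm (x t \<omega> - y))\<^sup>2 \<partial>M)"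
    by (subst (asm) ennreal_le_iff) (auto simp: s_def)
qed

text \<open>
  The expected form of the one-step inequality. Dropping either of the two nonnegative terms on the
  left gives the recursion for the distances and the bound on the optimality gap.
\<close>

lemma expected_step:
  assumes noise: "multiplicative_noise P X gradF \<sigma>\<^sub>L"
    and t: "1 \<le> t" and \<alpha>L: "\<alpha> t * L < 1"
    and y: "y \<in> X" and minimal: "\<And>z. z \<in> X \<Longrightarrow> objective P F \<psi> y \<le> objective P F \<psi> z"
    and dist2: "integrable M (\<lambda>\<omega>. (norm (x t \<omega> - y))\<^sup>2)"
  shows "integrable M (\<lambda>\<omega>. (norm (x (t + 1) \<omega> - y))\<^sup>2)"
    and "integrable M (\<lambda>\<omega>. objective P F \<psi> (x (t + 1) \<omega>) - objective P F \<psi> y)"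
    and "(\<integral>\<omega>. objective P F \<psi> (x (t + 1) \<omega>) - objective P F \<psi> y \<partial>M)
        + 1 / (2 * \<alpha> t) * (\<integral>\<omega>. (norm (x (t + 1) \<omega> - y))\<^sup>2 \<partial>M)
      \<le> (1 / \<alpha> t - c) / 2 * (\<integral>\<omega>. (norm (x t \<omega> - y))\<^sup>2 \<partial>M)
        + \<alpha> t / (2 * (1 - \<alpha> t * L)) * ((2 * (enn2real (noise_sd P gradF y))\<^sup>2
            + 2 * \<sigma>\<^sub>L\<^sup>2 * (\<integral>\<omega>. (norm (x t \<omega> - y))\<^sup>2 \<partial>M)) / real (N t))"
proof -
  define gap where "gap \<omega> = objective P F \<psi> (x (t + 1) \<omega>) - objective P F \<psi> y" for \<omega>
  define d where "d \<omega> = (norm (x (t + 1) \<omega> - y))\<^sup>2" for \<omega>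
  define R where "R \<omega> = (1 / \<alpha> t - c) / 2 * (norm (x t \<omega> - y))\<^sup>2
      + \<alpha> t / (2 * (1 - \<alpha> t * L)) * (norm (batch_noise t \<omega>))\<^sup>2
      - batch_noise t \<omega> \<bullet> (x t \<omega> - y)" for \<omega>
  define B where "B = 2 * (enn2real (noise_sd P gradF y))\<^sup>2
      + 2 * \<sigma>\<^sub>L\<^sup>2 * (\<integral>\<omega>. (norm (x t \<omega> - y))\<^sup>2 \<partial>M)"
  have \<alpha>: "\<alpha> t > 0" using \<alpha>_pos[OF t] .
  note single = gradient_noise_second_moment[OF noise t _ _ y dist2, folded B_def]
  note batch = batch_noise_second_moment[OF t single]
  note orth = batch_noise_orthogonal[OF t single(1) dist2]
  have R_int: "integrable M R"
    unfolding R_def[abs_def] using dist2 batch(1) orth(1) by simp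
  have step: "gap \<omega> + 1 / (2 * \<alpha> t) * d \<omega> \<le> R \<omega>" if "\<omega> \<in> space M" for \<omega>
    using one_step[OF t that y \<alpha>L] by (simp add: gap_def d_def R_def)
  have gap_nonneg: "0 \<le> gap \<omega>" if "\<omega> \<in> space M" for \<omega>
    using minimal[OF iterate_in[of "t + 1" \<omega>]] that by (simp add: gap_def)
  have d_nonneg: "0 \<le> d \<omega>" for \<omega> by (simp add: d_def)
  have "x (t + 1) \<in> borel_measurable M"
    by (rule iterate_borel_measurable) simp
  then have d_meas: "d \<in> borel_measurable M"
    unfolding d_def[abs_def] by measurable
  have gap_meas: "gap \<in> borel_measurable M"
    using objective_iterate_measurable[OF t] unfolding gap_def[abs_def] by measurable
  have d_int: "integrable M d"
  proof (rule Bochner_Integration.integrable_bound)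
    show "integrable M (\<lambda>\<omega>. 2 * \<alpha> t * R \<omega>)" using R_int by simp
    show "AE \<omega> in M. norm (d \<omega>) \<le> norm (2 * \<alpha> t * R \<omega>)"
    proof (rule AE_I2)
      fix \<omega> assume "\<omega> \<in> space M"
      then have "1 / (2 * \<alpha> t) * d \<omega> \<le> R \<omega>"
        using step[of \<omega>] gap_nonneg[of \<omega>] by linarith
      then have "d \<omega> \<le> 2 * \<alpha> t * R \<omega>" using \<alpha> by (simp add: field_simps)
      then show "norm (d \<omega>) \<le> norm (2 * \<alpha> t * R \<omega>)" using d_nonneg[of \<omega>] by simp
    qed
  qed (rule d_meas)
  have gap_int: "integrable M gap"
  proof (rule Bochner_Integration.integrable_bound[OF R_int gap_meas], rule AE_I2)
    fix \<omega> assume "\<omega> \<in> space M"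
    moreover have "0 \<le> 1 / (2 * \<alpha> t) * d \<omega>" using \<alpha> d_nonneg by simp
    ultimately show "norm (gap \<omega>) \<le> norm (R \<omega>)"
      using step[of \<omega>] gap_nonneg[of \<omega>] by simp
  qed
  show "integrable M (\<lambda>\<omega>. (norm (x (t + 1) \<omega> - y))\<^sup>2)"
    using d_int by (simp add: d_def[abs_def])
  show "integrable M (\<lambda>\<omega>. objective P F \<psi> (x (t + 1) \<omega>) - objective P F \<psi> y)"
    using gap_int by (simp add: gap_def[abs_def])
  have "(\<integral>\<omega>. gap \<omega> \<partial>M) + 1 / (2 * \<alpha> t) * (\<integral>\<omega>. d \<omega> \<partial>M)
      = (\<integral>\<omega>. gap \<omega> + 1 / (2 * \<alpha> t) * d \<omega> \<partial>M)"
    using gap_int d_int by simp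
  also have "\<dots> \<le> (\<integral>\<omega>. R \<omega> \<partial>M)"
    using gap_int d_int R_int step by (intro integral_mono) auto
  also have "\<dots> = (1 / \<alpha> t - c) / 2 * (\<integral>\<omega>. (norm (x t \<omega> - y))\<^sup>2 \<partial>M)
      + \<alpha> t / (2 * (1 - \<alpha> t * L)) * (\<integral>\<omega>. (norm (batch_noise t \<omega>))\<^sup>2 \<partial>M)"
    unfolding R_def using dist2 batch(1) orth by simp
  also have "\<dots> \<le> (1 / \<alpha> t - c) / 2 * (\<integral>\<omega>. (norm (x t \<omega> - y))\<^sup>2 \<partial>M)
      + \<alpha> t / (2 * (1 - \<alpha> t * L)) * (B / real (N t))"
    using batch(2) \<alpha> \<alpha>L by (intro add_left_mono mult_left_mono) auto
  finally show "(\<integral>\<omega>. objective P F \<psi> (x (t + 1) \<omega>) - objective P F \<psi> y \<partial>M)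
        + 1 / (2 * \<alpha> t) * (\<integral>\<omega>. (norm (x (t + 1) \<omega> - y))\<^sup>2 \<partial>M)
      \<le> (1 / \<alpha> t - c) / 2 * (\<integral>\<omega>. (norm (x t \<omega> - y))\<^sup>2 \<partial>M)
        + \<alpha> t / (2 * (1 - \<alpha> t * L)) * ((2 * (enn2real (noise_sd P gradF y))\<^sup>2
            + 2 * \<sigma>\<^sub>L\<^sup>2 * (\<integral>\<omega>. (norm (x t \<omega> - y))\<^sup>2 \<partial>M)) / real (N t))"
    by (simp add: gap_def d_def B_def)
qed

end


section \<open>Linear recursions with a geometric perturbation\<close>

text \<open>
  The induction step works once \<open>C \<ge> b / (\<rho> - a)\<close>; the remaining slack in \<open>C\<close> covers the finitely
  many indices before the recursion sets in.
\<close>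

lemma geometric_bound_of_recursion:
  fixes D :: "nat \<Rightarrow> real"
  assumes a: "0 \<le> a" "a < \<rho>" and b: "0 \<le> b" and \<zeta>: "0 \<le> \<zeta>" "\<zeta> \<le> \<rho>"
    and D: "\<And>t. 0 \<le> D t"
    and rec: "\<And>t. T \<le> t \<Longrightarrow> D (Suc t) \<le> a * D t + b * \<zeta> ^ t"
  shows "\<exists>C>0. \<forall>t. D t \<le> C * \<rho> ^ t"
proof -
  define C where "C = (\<Sum>t\<le>T. D t / \<rho> ^ t) + b / (\<rho> - a) + 1"
  have "\<rho> > 0" using a by simp
  have sum_nonneg: "0 \<le> (\<Sum>t\<le>T. D t / \<rho> ^ t)"
    using D \<open>\<rho> > 0\<close> by (intro sum_nonneg) simp
  have "0 \<le> b / (\<rho> - a)" using a b by simp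
  then have "C > 0" using sum_nonneg unfolding C_def by linarith
  have init: "D t \<le> C * \<rho> ^ t" if "t \<le> T" for t
  proof -
    have "D t / \<rho> ^ t \<le> (\<Sum>t\<le>T. D t / \<rho> ^ t)"
      using that D \<open>\<rho> > 0\<close> by (intro member_le_sum) auto
    also have "\<dots> \<le> C" using \<open>0 \<le> b / (\<rho> - a)\<close> unfolding C_def by linarith
    finally show ?thesis using \<open>\<rho> > 0\<close> by (simp add: field_simps)
  qed
  have "b / (\<rho> - a) \<le> C" using sum_nonneg unfolding C_def by linarith
  then have "a * C + b \<le> C * \<rho>" using a by (simp add: field_simps)
  have late: "D (T + k) \<le> C * \<rho> ^ (T + k)" for k
  proof (induction k)
    case 0
    then show ?case using init by simp
  next
    case (Suc k)
    have "D (T + Suc k) \<le> a * D (T + k) + b * \<zeta> ^ (T + k)"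
      using rec[of "T + k"] by simp
    also have "\<dots> \<le> a * (C * \<rho> ^ (T + k)) + b * \<rho> ^ (T + k)"
      using Suc a b \<zeta> by (intro add_mono mult_left_mono power_mono) auto
    also have "\<dots> = (a * C + b) * \<rho> ^ (T + k)" by (simp add: algebra_simps)
    also have "\<dots> \<le> (C * \<rho>) * \<rho> ^ (T + k)"
      using \<open>a * C + b \<le> C * \<rho>\<close> \<open>\<rho> > 0\<close> by (intro mult_right_mono) auto
    finally show ?case by (simp add: mult_ac)
  qed
  have "D t \<le> C * \<rho> ^ t" for t
    using init[of t] late[of "t - T"] by (cases "t \<le> T") auto
  with \<open>C > 0\<close> show ?thesis by blast
qed


section \<open>Convergence rate\<close>

text \<open>
  Rounding up can only enlarge a batch, so \<open>1 / N t\<close> inherits the geometric decay of \<open>\<zeta> ^ t\<close>.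
\<close>

lemma inverse_geometric_batch_le:
  assumes "0 < \<zeta>" and "N\<^sub>0 \<ge> (1 :: nat)"
  shows "1 / real (N\<^sub>0 * nat \<lceil>\<zeta> powi (- int t)\<rceil>) \<le> \<zeta> ^ t / real N\<^sub>0"
proof -
  have "\<zeta> powi (- int t) = 1 / \<zeta> ^ t"
    by (simp add: power_int_minus divide_inverse)
  then have "1 / \<zeta> ^ t \<le> real (nat \<lceil>\<zeta> powi (- int t)\<rceil>)"
    by (simp add: of_nat_ceiling)
  then have "real N\<^sub>0 * (1 / \<zeta> ^ t) \<le> real (N\<^sub>0 * nat \<lceil>\<zeta> powi (- int t)\<rceil>)"
    using assms by (simp only: of_nat_mult) (intro mult_left_mono, auto)
  moreover have "0 < real N\<^sub>0 * (1 / \<zeta> ^ t)"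
    using assms by simp
  ultimately have "1 / real (N\<^sub>0 * nat \<lceil>\<zeta> powi (- int t)\<rceil>) \<le> 1 / (real N\<^sub>0 * (1 / \<zeta> ^ t))"
    by (intro frac_le) simp_all
  then show ?thesis by simp
qed

text \<open>
  With \<open>\<alpha> t = \<mu> / L\<close> the expected step reads
  \<open>D (t + 1) \<le> (1 - \<mu> c / L + q \<zeta>\<^sup>t) D t + b \<zeta>\<^sup>t\<close> for \<open>D t = E \<parallel>x t - x\<^sub>s\<parallel>\<^sup>2\<close>, where \<open>q \<zeta>\<^sup>t\<close> stems
  from the part of the noise that grows with the distance to \<open>x\<^sub>s\<close>. Once \<open>q \<zeta>\<^sup>t \<le> \<phi>\<close>, which \<open>t\<^sub>0\<close>
  is chosen to ensure for all \<open>t \<ge> t\<^sub>0\<close>, the contraction factor is \<open>1 - \<mu> c / L + \<phi>\<close>. It lies below \<open>\<rho>\<close> by at least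
  \<open>\<mu> c / (2 L)\<close>, so the perturbation \<open>b \<zeta>\<^sup>t \<le> b \<rho>\<^sup>t\<close> does not spoil the rate \<open>\<rho>\<close>. The gap at \<open>t + 1\<close> is
  then bounded by the same inequality, with \<open>D (t + 1)\<close> dropped instead of the gap.
\<close>

theorem theorem2:
  fixes P :: "'b measure"
    and X :: "'a :: euclidean_space set"
    and F :: "'a \<Rightarrow> 'b \<Rightarrow> real"
    and gradF :: "'a \<Rightarrow> 'b \<Rightarrow> 'a"
    and \<psi> :: "'a \<Rightarrow> real"
    and L c \<sigma>\<^sub>L \<mu> \<phi> \<zeta> \<rho> gmin :: real
    and M :: "'w measure"
    and \<xi> :: "nat \<Rightarrow> nat \<Rightarrow> 'w \<Rightarrow> 'b"
    and \<alpha> :: "nat \<Rightarrow> real"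
    and N :: "nat \<Rightarrow> nat"
    and N\<^sub>0 :: nat
    and t\<^sub>0 :: int
    and x\<^sub>1 x\<^sub>s :: 'a
    and x :: "nat \<Rightarrow> 'w \<Rightarrow> 'a"
    and g :: "'a \<Rightarrow> real"
  assumes algorithm: "stochastic_prox_gradient P X F gradF \<psi> L c M \<xi> \<alpha> N x\<^sub>1 x"
    and noise: "multiplicative_noise P X gradF \<sigma>\<^sub>L"
    and g_def: "g = objective P F \<psi>"
    and gmin_def: "gmin = (INF y\<in>X. g y)"
    and minimizer: "unique_minimizer X g x\<^sub>s"
    and \<mu>: "0 < \<mu>" "\<mu> < 1"
    and \<phi>: "0 < \<phi>" "\<phi> < 1" "\<phi> < 1 - \<mu> * c / L"
    and \<zeta>: "0 < \<zeta>" "\<zeta> < 1"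
    and N\<^sub>0: "N\<^sub>0 \<ge> 1"
    and stepsize: "\<And>t. t \<ge> 1 \<Longrightarrow> \<alpha> t = \<mu> / L"
    and sampling_rate: "\<And>t. t \<ge> 1 \<Longrightarrow> N t = N\<^sub>0 * nat \<lceil>\<zeta> powi (- int t)\<rceil>"
    and \<rho>_def: "\<rho> = max (1 - \<mu> * (c / (2 * L)) + \<phi>) \<zeta>"
    and t\<^sub>0_def: "t\<^sub>0 = max \<lceil>log (1 / \<zeta>) (2 * \<mu>\<^sup>2 / ((1 - \<mu>) * \<phi> * real N\<^sub>0) * (\<sigma>\<^sub>L\<^sup>2 / L\<^sup>2))\<rceil> 1"
  shows "(\<rho> < 1 \<longleftrightarrow> \<phi> < \<mu> * (c / (2 * L))) \<and>
    (\<exists>C > 0.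
      (\<forall>t \<ge> 1. integrable M (\<lambda>\<omega>. (norm (x (t + 1) \<omega> - x\<^sub>s))\<^sup>2) \<and>
        (\<integral>\<omega>. (norm (x (t + 1) \<omega> - x\<^sub>s))\<^sup>2 \<partial>M) \<le> C * \<rho> ^ (t + 1)) \<and>
      (\<forall>t \<ge> 2. integrable M (\<lambda>\<omega>. g (x (t + 1) \<omega>) - gmin) \<and>
        (\<integral>\<omega>. (g (x (t + 1) \<omega>) - gmin) \<partial>M)
          \<le> ((L * inverse \<mu> - c) / 2 + 2 * \<mu> / ((1 - \<mu>) * real N\<^sub>0) * (\<sigma>\<^sub>L\<^sup>2 / L) * \<zeta> ^ t) * (C * \<rho> ^ t)
            + 2 * \<mu> / ((1 - \<mu>) * real N\<^sub>0) * ((enn2real (noise_sd P gradF x\<^sub>s))\<^sup>2 / L) * \<zeta> ^ t))"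
proof -
  interpret stochastic_prox_gradient P X F gradF \<psi> L c M \<xi> \<alpha> N x\<^sub>1 x by (rule algorithm)
  interpret prob_space M by (rule prob_M)
  define D where "D t = (\<integral>\<omega>. (norm (x t \<omega> - x\<^sub>s))\<^sup>2 \<partial>M)" for t
  define gap where "gap t = (\<integral>\<omega>. (g (x (t + 1) \<omega>) - gmin) \<partial>M)" for t
  define s where "s = enn2real (noise_sd P gradF x\<^sub>s)"
  define A where "A = 2 * \<mu> / ((1 - \<mu>) * real N\<^sub>0)"
  define h where "h = (L * inverse \<mu> - c) / 2"
  have xs: "x\<^sub>s \<in> X" and minimal: "\<And>z. z \<in> X \<Longrightarrow> g x\<^sub>s \<le> g z"
    using minimizer by (auto simp: unique_minimizer_def is_arg_min_def not_less)
  then have gmin: "gmin = g x\<^sub>s"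
    unfolding gmin_def by (intro cInf_eq_minimum) auto
  have D_nonneg: "0 \<le> D t" for t by (simp add: D_def)
  have "A > 0" using \<mu> N\<^sub>0 by (simp add: A_def)
  have "\<mu> * c < L" using \<phi> L_pos by (simp add: field_simps) (smt (verit) mult_pos_pos)
  then have "h \<ge> 0" using \<mu> by (simp add: h_def field_simps)
  have \<alpha>L: "\<alpha> t * L < 1" if "1 \<le> t" for t
    using stepsize[OF that] \<mu> L_pos by simp
  note step = expected_step[OF noise _ \<alpha>L xs minimal[unfolded g_def], folded g_def gmin]
  have dist_int: "integrable M (\<lambda>\<omega>. (norm (x t \<omega> - x\<^sub>s))\<^sup>2)" if "1 \<le> t" for t
    using that
  proof (induction t rule: nat_induct_at_least)
    case base
    have "integrable M (\<lambda>\<omega>. (norm (x 1 \<omega> - x\<^sub>s))\<^sup>2) \<longleftrightarrow> integrable M (\<lambda>\<omega>. (norm (x\<^sub>1 - x\<^sub>s))\<^sup>2)"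
      by (rule Bochner_Integration.integrable_cong) (simp_all add: x_init del: One_nat_def)
    then show ?case by simp
  next
    case (Suc t)
    then show ?case using step(1)[of t] by simp
  qed
  have gap_int: "integrable M (\<lambda>\<omega>. g (x (t + 1) \<omega>) - gmin)" if "1 \<le> t" for t
    using step(2) dist_int that by simp
  have gap_nonneg: "0 \<le> gap t" if "1 \<le> t" for t
    unfolding gap_def gmin using iterate_in[of "t + 1"] minimal by (intro integral_nonneg_AE AE_I2) auto
  have main: "gap t + L / (2 * \<mu>) * D (Suc t) \<le> h * D t + A / 2 * (s\<^sup>2 / L + \<sigma>\<^sub>L\<^sup>2 / L * D t) * \<zeta> ^ t"
    if t: "1 \<le> t" for t
  proof -
    have coeffs: "1 / (\<mu> / L) = L * inverse \<mu>" "1 / (2 * (\<mu> / L)) = L / (2 * \<mu>)" "\<mu> / L * L = \<mu>"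
      using L_pos \<mu> by (simp_all add: field_simps)
    have "gap t + L / (2 * \<mu>) * D (Suc t)
        \<le> h * D t + \<mu> / L / (2 * (1 - \<mu>)) * ((2 * s\<^sup>2 + 2 * \<sigma>\<^sub>L\<^sup>2 * D t) * (1 / real (N t)))"
      using step(3)[OF t t _ dist_int[OF t]] unfolding stepsize[OF t] coeffs
      by (simp add: gap_def D_def s_def h_def)
    also have "\<dots> \<le> h * D t + \<mu> / L / (2 * (1 - \<mu>)) * ((2 * s\<^sup>2 + 2 * \<sigma>\<^sub>L\<^sup>2 * D t) * (\<zeta> ^ t / real N\<^sub>0))"
      using inverse_geometric_batch_le[OF \<zeta>(1) N\<^sub>0, of t] \<mu> L_pos D_nonneg[of t] sampling_rate[OF t]
      by (intro add_left_mono mult_left_mono) auto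
    also have "\<dots> = h * D t + A / 2 * (s\<^sup>2 / L + \<sigma>\<^sub>L\<^sup>2 / L * D t) * \<zeta> ^ t"
      using \<mu> L_pos N\<^sub>0 by (simp add: A_def field_simps)
    finally show ?thesis .
  qed
  define q where "q = A * \<mu> * \<sigma>\<^sub>L\<^sup>2 / L\<^sup>2"
  define b where "b = A * \<mu> * s\<^sup>2 / L\<^sup>2"
  define a where "a = 1 - \<mu> * c / L + \<phi>"
  have rec: "D (Suc t) \<le> (1 - \<mu> * c / L + q * \<zeta> ^ t) * D t + b * \<zeta> ^ t" if t: "1 \<le> t" for t
  proof -
    have "D (Suc t) = 2 * \<mu> / L * (L / (2 * \<mu>) * D (Suc t))"
      using \<mu> L_pos by simp
    also have "\<dots> \<le> 2 * \<mu> / L * (h * D t + A / 2 * (s\<^sup>2 / L + \<sigma>\<^sub>L\<^sup>2 / L * D t) * \<zeta> ^ t)"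
      using main[OF t] gap_nonneg[OF t] \<mu> L_pos by (intro mult_left_mono) auto
    also have "\<dots> = (1 - \<mu> * c / L + q * \<zeta> ^ t) * D t + b * \<zeta> ^ t"
      using \<mu> L_pos by (simp add: h_def q_def b_def field_simps power2_eq_square)
    finally show ?thesis .
  qed
  have "(\<lambda>t. q * \<zeta> ^ t) \<longlonglongrightarrow> q * 0"
    using \<zeta> by (intro tendsto_mult_left LIMSEQ_realpow_zero) auto
  then have "eventually (\<lambda>t. q * \<zeta> ^ t < \<phi>) sequentially"
    using \<phi>(1) by (auto dest: order_tendstoD(2))
  then obtain T where T: "\<And>t. T \<le> t \<Longrightarrow> q * \<zeta> ^ t < \<phi>"
    by (auto simp: eventually_sequentially)
  \<comment> \<open>The first step leads from iterate \<open>1\<close> to iterate \<open>2\<close>, hence the bound \<open>max T 1\<close> below.\<close>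
  have "\<exists>C>0. \<forall>t. D t \<le> C * \<rho> ^ t"
  proof (rule geometric_bound_of_recursion)
    show "0 \<le> a" using \<phi> by (simp add: a_def)
    have "\<mu> * (c / (2 * L)) < \<mu> * c / L" using \<mu> c_pos L_pos by (simp add: field_simps)
    then show "a < \<rho>" by (simp add: a_def \<rho>_def less_max_iff_disj)
    show "0 \<le> b" using \<open>A > 0\<close> \<mu> by (simp add: b_def)
    show "0 \<le> \<zeta>" "\<zeta> \<le> \<rho>" using \<zeta> by (auto simp: \<rho>_def)
    show "D (Suc t) \<le> a * D t + b * \<zeta> ^ t" if "max T 1 \<le> t" for t
    proof -
      have "(1 - \<mu> * c / L + q * \<zeta> ^ t) * D t \<le> a * D t"
        using T[of t] that D_nonneg[of t] by (intro mult_right_mono) (auto simp: a_def)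
      then show ?thesis using rec[of t] that by simp
    qed
  qed (rule D_nonneg)
  then obtain C where C: "C > 0" "\<And>t. D t \<le> C * \<rho> ^ t" by blast
  have gap_le: "gap t \<le> (h + A * (\<sigma>\<^sub>L\<^sup>2 / L) * \<zeta> ^ t) * (C * \<rho> ^ t) + A * (s\<^sup>2 / L) * \<zeta> ^ t"
    if t: "1 \<le> t" for t
  proof -
    have "0 \<le> L / (2 * \<mu>) * D (Suc t)" using \<mu> L_pos D_nonneg by simp
    then have "gap t \<le> h * D t + A / 2 * (s\<^sup>2 / L + \<sigma>\<^sub>L\<^sup>2 / L * D t) * \<zeta> ^ t"
      using main[OF t] by linarith
    also have "\<dots> \<le> h * D t + A * (s\<^sup>2 / L + \<sigma>\<^sub>L\<^sup>2 / L * D t) * \<zeta> ^ t"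
      using \<open>A > 0\<close> L_pos D_nonneg[of t] \<zeta> by (intro add_left_mono mult_right_mono) auto
    also have "\<dots> = (h + A * (\<sigma>\<^sub>L\<^sup>2 / L) * \<zeta> ^ t) * D t + A * (s\<^sup>2 / L) * \<zeta> ^ t"
      by (simp add: algebra_simps)
    also have "\<dots> \<le> (h + A * (\<sigma>\<^sub>L\<^sup>2 / L) * \<zeta> ^ t) * (C * \<rho> ^ t) + A * (s\<^sup>2 / L) * \<zeta> ^ t"
      using C(2)[of t] \<open>h \<ge> 0\<close> \<open>A > 0\<close> L_pos \<zeta>
      by (intro add_right_mono mult_left_mono) auto
    finally show ?thesis .
  qed
  have "\<rho> < 1 \<longleftrightarrow> \<phi> < \<mu> * (c / (2 * L))"
    using \<zeta> by (auto simp: \<rho>_def)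
  moreover have "integrable M (\<lambda>\<omega>. (norm (x (t + 1) \<omega> - x\<^sub>s))\<^sup>2)"
    and "(\<integral>\<omega>. (norm (x (t + 1) \<omega> - x\<^sub>s))\<^sup>2 \<partial>M) \<le> C * \<rho> ^ (t + 1)" for t
    using dist_int[of "t + 1"] C(2)[of "t + 1"] by (simp_all add: D_def)
  ultimately show ?thesis
    using C(1) gap_int gap_le unfolding gap_def h_def A_def s_def
    by (intro conjI exI[of _ C] allI impI) auto
qed

end
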